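(* Let $N\ge1$, let $\{S^e\}_{e=1}^E$ be a non-overlapping partition of $\mathbb S^2$ into elements that are rectangles $S^e=[\theta_{s-1},\theta_s]\times[\varphi_{t-1},\varphi_t]$ in the $(\theta,\varphi)$-coordinates ($s=s(e)$, $t=t(e)$), let $\{U_{ij}^e,V_{ij}^e,W_{ij}^e\}_{0\le i,j\le N,\,1\le e\le E}$ be given nodal values, and let $\boldsymbol v_N^E=u_N^E\boldsymbol e_r+v_N^E\boldsymbol e_\theta+w_N^E\boldsymbol e_\varphi$ be the piecewise vector field on $\mathbb S^2$ whose components on each $S^e$ are $$\{u_N^E,v_N^E,w_N^E\}(\theta,\varphi)=\sum_{i=0}^N\sum_{j=0}^N\{U_{ij}^e,V_{ij}^e,W_{ij}^e\}\,\psi_{ij}(\mathcal F_e^{-1}(\theta,\varphi)).$$ Define, for $|m|\le l$, $$\tilde v_{lm}^r=\int_{\mathbb S^2}\boldsymbol v_N^E\cdot\overline{\boldsymbol Y_l^m}\,dS\ (l\ge0),\quad \tilde v_{lm}^{(1)}=\frac1{l(l+1)}\int_{\mathbb S^2}\boldsymbol v_N^E\cdot\overline{\boldsymbol\Psi_l^m}\,dS\ (l\ge1),\quad \tilde v_{lm}^{(2)}=\frac1{l(l+1)}\int_{\mathbb S^2}\boldsymbol v_N^E\cdot\overline{\boldsymbol\Phi_l^m}\,dS\ (l\ge1).$$ Then $$\tilde v_{lm}^r=\sum_{e=1}^E\sum_{i=0}^N\sum_{j=0}^NU_{ij}^e\,\mathfrak a_{m,i}^t\,\mathfrak b_{l,m,j}^s\qquad(l\ge0),$$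 and, for $l\ge1$, $$\tilde v_{lm}^{(1)}=\frac1{l(l+1)}\sum_{e=1}^E\sum_{i=0}^N\sum_{j=0}^N\mathfrak a_{m,i}^t\big\{V_{ij}^e\,\mathfrak d_{l,m,j}^s-\mathrm i m\,W_{ij}^e\,\mathfrak c_{l,m,j}^s\big\},$$ $$\tilde v_{lm}^{(2)}=\frac{-1}{l(l+1)}\sum_{e=1}^E\sum_{i=0}^N\sum_{j=0}^N\mathfrak a_{m,i}^t\big\{\mathrm i m\,V_{ij}^e\,\mathfrak c_{l,m,j}^s+W_{ij}^e\,\mathfrak d_{l,m,j}^s\big\},$$ where $$\mathfrak c_{l,m,j}^s=\hat\theta_s\sum_{n=0}^Nv_{jn}\,\mathscr P_{lm}^n(\hat\theta_s,\alpha_s),\qquad \mathfrak d_{l,0,j}^s=-\sqrt{l(l+1)}\,\mathfrak b_{l,1,j}^s,\qquad \mathfrak d_{l,l,j}^s=\sqrt{l/2}\,\mathfrak b_{l,l-1,j}^s,$$ $$\mathfrak d_{l,m,j}^s=\tilde c_l^{m,1}\mathfrak b_{l,m-1,j}^s-\tilde c_l^{m,2}\mathfrak b_{l,m+1,j}^s,\quad m=1,\dots,l-1,\qquad \tilde c_l^{m,1}=\tfrac12\sqrt{(l+m)(l-m+1)},\quad \tilde c_l^{m,2}=\tfrac12\sqrt{(l+m+1)(l-m)},$$ $\mathfrak d_{l,-m,j}^s=(-1)^m\mathfrak d_{l,m,j}^s$ for $0<m\le l$, and $$\mathscr P^n_{lm}(\lambda,\rho):=\int_{-1}^1P_n(x)\,\widehat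 P_l^m(\cos(\lambda x+\rho))\,dx$$ ($\lambda,\rho\in\mathbb R$) can be computed by $$\mathscr P^n_{lm}(\lambda,\rho)=\begin{cases} \sum_{k=0}^{l/2}A_{lm}^k\,\mathscr C_n(2k\lambda,2k\rho), & l\text{ even},\ m\text{ even},\\ \sum_{k=1}^{l/2}A_{lm}^k\,\mathscr S_n(2k\lambda,2k\rho), & l\text{ even},\ m\text{ odd},\\ \sum_{k=1}^{(l+1)/2}A_{lm}^k\,\mathscr C_n((2k-1)\lambda,(2k-1)\rho), & l\text{ odd},\ m\text{ even},\\ \sum_{k=1}^{(l+1)/2}A_{lm}^k\,\mathscr S_n((2k-1)\lambda,(2k-1)\rho), & l\text{ odd},\ m\text{ odd}. \end{cases}$$
   Context: Spherical coordinates on the unit sphere $\mathbb S^2$: $\theta\in[0,\pi]$ is the polar angle, $\varphi\in[0,2\pi)$ the azimuthal angle, $dS=\sin\theta\,d\theta\,d\varphi$; $\{\boldsymbol e_r,\boldsymbol e_\theta,\boldsymbol e_\varphi\}$ are the unit coordinate vectors, a right-handed orthonormal frame. The dot product is bilinear: $\boldsymbol a\cdot\boldsymbol b=\sum_i a_ib_i$. Legendre functions and spherical harmonics: $P_l$ is the Legendre polynomial of degree $l$. For $0\le m\le l$, $P_l^m(x)=(-1)^m(1-x^2)^{m/2}\frac{d^m}{dx^m}P_l(x)$, and $P_l^{-m}=(-1)^m\frac{(l-m)!}{(l+m)!}P_l^m$ for $0<m\le l$. For $|m|\le l$, $\widehat P_l^m:=(-1)^mc_l^mP_l^m$ with $c_l^m=\sqrt{\frac{2l+1}{4\pi}\frac{(l-m)!}{(l+m)!}}$,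 and $Y_l^m(\theta,\varphi)=\widehat P_l^m(\cos\theta)e^{\mathrm i m\varphi}$. Vector spherical harmonics: $\boldsymbol Y_l^m=Y_l^m\boldsymbol e_r$, $\boldsymbol\Psi_l^m=\frac{\partial Y_l^m}{\partial\theta}\boldsymbol e_\theta+\frac1{\sin\theta}\frac{\partial Y_l^m}{\partial\varphi}\boldsymbol e_\varphi$, $\boldsymbol\Phi_l^m=\frac1{\sin\theta}\frac{\partial Y_l^m}{\partial\varphi}\boldsymbol e_\theta-\frac{\partial Y_l^m}{\partial\theta}\boldsymbol e_\varphi$. Trigonometric coefficients $A_{lm}^k$: they are the coefficients in the expansions $\widehat P_l^m(\cos\theta)=\sum_{k=0}^{l/2}A_{lm}^k\cos(2k\theta)$ ($l$ even, $m$ even); $\widehat P_l^m(\cos\theta)=\sum_{k=1}^{l/2}A_{lm}^k\sin(2k\theta)$ ($l$ even, $m$ odd); $\widehat P_l^m(\cos\theta)=\sum_{k=1}^{(l+1)/2}A_{lm}^k\cos((2k-1)\theta)$ ($l$ odd, $m$ even); $\widehat P_l^m(\cos\theta)=\sum_{k=1}^{(l+1)/2}A_{lm}^k\sin((2k-1)\theta)$ ($l$ odd, $m$ odd). Spectral-element setting: for an element $S^e=[\theta_{s-1},\theta_s]\times[\varphi_{t-1},\varphi_t]$ set $\hat\theta_s=\frac{\theta_s-\theta_{s-1}}2$, $\alpha_s=\frac{\theta_{s-1}+\theta_s}2$, $\hat\varphi_t=\frac{\varphi_t-\varphi_{t-1}}2$, $\beta_t=\frac{\varphi_{t-1}+\varphi_t}2$.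 The elemental mapping $\mathcal F_e:[-1,1]^2\to S^e$ is $\mathcal F_e(\eta,\xi)=(\hat\theta_s\eta+\alpha_s,\ \hat\varphi_t\xi+\beta_t)$. Let $\{\xi_i\}_{i=0}^N$ be the Legendre–Gauss–Lobatto points on $[-1,1]$ (the zeros of $(1-x^2)P_N'(x)$), $\{l_i\}_{i=0}^N$ the Lagrange interpolating basis polynomials of degree $N$ at these points, and $\psi_{ij}(\eta,\xi)=l_i(\xi)l_j(\eta)$. The numbers $v_{in}$ are the Legendre coefficients of the Lagrange basis: $l_i(\xi)=\sum_{n=0}^Nv_{in}P_n(\xi)$. $j_n$ is the spherical Bessel function of the first kind (an entire function), $\delta_{n0}$ the Kronecker delta. Further notation: $$\mathfrak a_{m,i}^t=\begin{cases}2v_{i0}\,\hat\varphi_t\,e^{-\mathrm i m\beta_t}, & m=0,\\ \hat\varphi_t\,e^{-\mathrm i m\beta_t}\sum_{n=0}^N2\,\mathrm i^{-n}v_{in}\,j_n(m\hat\varphi_t), & m\ne0,\end{cases}\qquad \mathfrak b_{l,m,j}^s=\hat\theta_s\sum_{n=0}^Nv_{jn}\,\mathscr Q_{lm}^n(\hat\theta_s,\alpha_s),$$ $$\mathscr Q^n_{lm}(\lambda,\rho)=\int_{-1}^1P_n(x)\,\widehat P_l^m(\cos(\lambda x+\rho))\sin(\lambda x+\rho)\,dx,$$ $$\mathscr C_n(\lambda,\rho)=\int_{-1}^1P_n(x)\cos(\lambda x+\rho)\,dx=\begin{cases}2\delta_{n0}\cos\rho,&\lambda=0,\\ 2j_n(\lambda)\big(\mathrm{Re}\{\mathrm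 i^{-n}\}\cos\rho+\mathrm{Im}\{\mathrm i^{-n}\}\sin\rho\big),&\lambda\ne0,\end{cases}$$ $$\mathscr S_n(\lambda,\rho)=\int_{-1}^1P_n(x)\sin(\lambda x+\rho)\,dx=\begin{cases}2\delta_{n0}\sin\rho,&\lambda=0,\\ 2j_n(\lambda)\big(\mathrm{Re}\{\mathrm i^{-n}\}\sin\rho-\mathrm{Im}\{\mathrm i^{-n}\}\cos\rho\big),&\lambda\ne0.\end{cases}$$
   Formalization: For odd m the formula for 𝒫 fails for some real λ, ρ (l=m=1, n=0, λ=0, ρ=−π/2), as (1−cos²θ)^{m/2}=|sin θ|^m. It is proved literally for even m or λx+ρ∈[0,π] on [−1,1], and for all λ, ρ, m with sin^m in place of |sin|^m. *)

theory Defs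
  imports "HOL-Analysis.Analysis" "HOL-Computational_Algebra.Polynomial"
begin

text \<open>Legendre polynomials by Rodrigues' formula.\<close>

definition legendre :: "nat \<Rightarrow> real poly" where
  "legendre n = smult (1 / (2 ^ n * fact n)) ((pderiv ^^ n) ([:-1, 0, 1:] ^ n))"

text \<open>The half-integer power \<open>(1 - x\<^sup>2)\<close> to the \<open>m/2\<close> is written as a natural power of the
  square root; these functions are only used for \<open>\<bar>x\<bar> \<le> 1\<close> and \<open>\<bar>m\<bar> \<le> l\<close>.\<close>

definition assoc_legendre_nonneg :: "nat \<Rightarrow> nat \<Rightarrow> real \<Rightarrow> real" where
  "assoc_legendre_nonneg l m x =
     (-1) ^ m * sqrt (1 - x\<^sup>2) ^ m * poly ((pderiv ^^ m) (legendre l)) x"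

definition assoc_legendre :: "nat \<Rightarrow> int \<Rightarrow> real \<Rightarrow> real" where
  "assoc_legendre l m x =
     (if m \<ge> 0 then assoc_legendre_nonneg l (nat m) x
      else (-1) ^ nat (- m) * (fact (l - nat (- m)) / fact (l + nat (- m)))
             * assoc_legendre_nonneg l (nat (- m)) x)"

definition norm_const :: "nat \<Rightarrow> int \<Rightarrow> real" where
  "norm_const l m =
     sqrt ((2 * real l + 1) / (4 * pi) * (fact (nat (int l - m)) / fact (nat (int l + m))))"

definition Phat :: "nat \<Rightarrow> int \<Rightarrow> real \<Rightarrow> real" where
  "Phat l m x = (-1) ^ nat \<bar>m\<bar> * norm_const l m * assoc_legendre l m x"

text \<open>The function \<open>Phat l m (cos \<theta>)\<close> of the polar angle \<open>\<theta> \<in> [0, \<pi>]\<close>, continued to all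
  real \<open>\<theta>\<close> as a trigonometric polynomial. Since \<open>sqrt (1 - cos\<^sup>2 \<theta>) = \<bar>sin \<theta>\<bar>\<close>, for odd \<open>m\<close> it
  differs from \<open>Phat l m (cos \<theta>)\<close> by a sign wherever \<open>sin \<theta> < 0\<close>.\<close>

definition Phat_angle :: "nat \<Rightarrow> int \<Rightarrow> real \<Rightarrow> real" where
  "Phat_angle l m \<theta> = (if sin \<theta> < 0 then (-1) ^ nat \<bar>m\<bar> else 1) * Phat l m (cos \<theta>)"

definition Ylm :: "nat \<Rightarrow> int \<Rightarrow> real \<Rightarrow> real \<Rightarrow> complex" where
  "Ylm l m \<theta> \<phi> = of_real (Phat l m (cos \<theta>)) * exp (\<i> * of_int m * of_real \<phi>)"


text \<open>The coordinate frame in Cartesian components, embedded in \<open>\<complex>\<^sup>3\<close>.\<close>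

definition e_r :: "real \<Rightarrow> real \<Rightarrow> complex ^ 3" where
  "e_r \<theta> \<phi> = vector [of_real (sin \<theta> * cos \<phi>), of_real (sin \<theta> * sin \<phi>), of_real (cos \<theta>)]"

definition e_theta :: "real \<Rightarrow> real \<Rightarrow> complex ^ 3" where
  "e_theta \<theta> \<phi> = vector [of_real (cos \<theta> * cos \<phi>), of_real (cos \<theta> * sin \<phi>), of_real (- sin \<theta>)]"

definition e_phi :: "real \<Rightarrow> real \<Rightarrow> complex ^ 3" where
  "e_phi \<theta> \<phi> = vector [of_real (- sin \<phi>), of_real (cos \<phi>), 0]"

text \<open>The bilinear dot product; the library's inner product on \<open>complex ^ 3\<close> is a different,
  real-valued one.\<close>

definition bdot :: "complex ^ 3 \<Rightarrow> complex ^ 3 \<Rightarrow> complex" where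
  "bdot a b = (\<Sum>i\<in>UNIV. a $ i * b $ i)"

definition vcnj :: "complex ^ 3 \<Rightarrow> complex ^ 3" where
  "vcnj a = (\<chi> i. cnj (a $ i))"

definition dtheta_Ylm :: "nat \<Rightarrow> int \<Rightarrow> real \<Rightarrow> real \<Rightarrow> complex" where
  "dtheta_Ylm l m \<theta> \<phi> = vector_derivative (\<lambda>t. Ylm l m t \<phi>) (at \<theta>)"

definition dphi_Ylm :: "nat \<Rightarrow> int \<Rightarrow> real \<Rightarrow> real \<Rightarrow> complex" where
  "dphi_Ylm l m \<theta> \<phi> = vector_derivative (\<lambda>t. Ylm l m \<theta> t) (at \<phi>)"

text \<open>The values of \<open>Psi_vec\<close> and \<open>Phi_vec\<close> at the poles (where \<open>sin \<theta> = 0\<close>) are immaterial: they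
  only enter through integrals.\<close>

definition Y_vec :: "nat \<Rightarrow> int \<Rightarrow> real \<Rightarrow> real \<Rightarrow> complex ^ 3" where
  "Y_vec l m \<theta> \<phi> = Ylm l m \<theta> \<phi> *s e_r \<theta> \<phi>"

definition Psi_vec :: "nat \<Rightarrow> int \<Rightarrow> real \<Rightarrow> real \<Rightarrow> complex ^ 3" where
  "Psi_vec l m \<theta> \<phi> = dtheta_Ylm l m \<theta> \<phi> *s e_theta \<theta> \<phi>
     + (of_real (1 / sin \<theta>) * dphi_Ylm l m \<theta> \<phi>) *s e_phi \<theta> \<phi>"

definition Phi_vec :: "nat \<Rightarrow> int \<Rightarrow> real \<Rightarrow> real \<Rightarrow> complex ^ 3" where
  "Phi_vec l m \<theta> \<phi> = (of_real (1 / sin \<theta>) * dphi_Ylm l m \<theta> \<phi>) *s e_theta \<theta> \<phi>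
     - dtheta_Ylm l m \<theta> \<phi> *s e_phi \<theta> \<phi>"

definition sphere_integral :: "(real \<Rightarrow> real \<Rightarrow> complex) \<Rightarrow> complex" where
  "sphere_integral f =
     integral (cbox (0, 0) (pi, 2 * pi)) (\<lambda>(\<theta>, \<phi>). of_real (sin \<theta>) * f \<theta> \<phi>)"

definition vsh_coeff_r :: "(real \<Rightarrow> real \<Rightarrow> complex ^ 3) \<Rightarrow> nat \<Rightarrow> int \<Rightarrow> complex" where
  "vsh_coeff_r F l m = sphere_integral (\<lambda>\<theta> \<phi>. bdot (F \<theta> \<phi>) (vcnj (Y_vec l m \<theta> \<phi>)))"

definition vsh_coeff_1 :: "(real \<Rightarrow> real \<Rightarrow> complex ^ 3) \<Rightarrow> nat \<Rightarrow> int \<Rightarrow> complex" where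
  "vsh_coeff_1 F l m = 1 / of_nat (l * (l + 1))
     * sphere_integral (\<lambda>\<theta> \<phi>. bdot (F \<theta> \<phi>) (vcnj (Psi_vec l m \<theta> \<phi>)))"

definition vsh_coeff_2 :: "(real \<Rightarrow> real \<Rightarrow> complex ^ 3) \<Rightarrow> nat \<Rightarrow> int \<Rightarrow> complex" where
  "vsh_coeff_2 F l m = 1 / of_nat (l * (l + 1))
     * sphere_integral (\<lambda>\<theta> \<phi>. bdot (F \<theta> \<phi>) (vcnj (Phi_vec l m \<theta> \<phi>)))"


text \<open>The power series \<open>z\<^sup>n \<Sum>\<^sub>k (- z\<^sup>2 / 2)\<^sup>k / (k! (2n + 2k + 1)!!)\<close>, with the double factorial
  written through ordinary ones.\<close>

definition sph_bessel :: "nat \<Rightarrow> 'a::{real_normed_field,banach} \<Rightarrow> 'a" where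
  "sph_bessel n z =
     (\<Sum>k. (-1) ^ k * (2 ^ n * fact (n + k) / (fact k * fact (2 * n + 2 * k + 1))) * z ^ (n + 2 * k))"

definition calQ :: "nat \<Rightarrow> nat \<Rightarrow> int \<Rightarrow> real \<Rightarrow> real \<Rightarrow> real" where
  "calQ n l m lam \<rho> = integral {-1..1}
     (\<lambda>x. poly (legendre n) x * Phat l m (cos (lam * x + \<rho>)) * sin (lam * x + \<rho>))"

definition calP :: "nat \<Rightarrow> nat \<Rightarrow> int \<Rightarrow> real \<Rightarrow> real \<Rightarrow> real" where
  "calP n l m lam \<rho> = integral {-1..1}
     (\<lambda>x. poly (legendre n) x * Phat l m (cos (lam * x + \<rho>)))"

definition calP_angle :: "nat \<Rightarrow> nat \<Rightarrow> int \<Rightarrow> real \<Rightarrow> real \<Rightarrow> real" where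
  "calP_angle n l m lam \<rho> = integral {-1..1}
     (\<lambda>x. poly (legendre n) x * Phat_angle l m (lam * x + \<rho>))"

definition calC :: "nat \<Rightarrow> real \<Rightarrow> real \<Rightarrow> real" where
  "calC n lam \<rho> = integral {-1..1} (\<lambda>x. poly (legendre n) x * cos (lam * x + \<rho>))"

definition calS :: "nat \<Rightarrow> real \<Rightarrow> real \<Rightarrow> real" where
  "calS n lam \<rho> = integral {-1..1} (\<lambda>x. poly (legendre n) x * sin (lam * x + \<rho>))"

text \<open>The common shape of the parity-dependent trigonometric sums: \<open>C k\<close> and \<open>S k\<close> are the cosine
  and sine terms of frequency \<open>k\<close>.\<close>

definition trig_sum :: "nat \<Rightarrow> int \<Rightarrow> (nat \<Rightarrow> real) \<Rightarrow> (nat \<Rightarrow> real) \<Rightarrow> (nat \<Rightarrow> real) \<Rightarrow> real" where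
  "trig_sum l m a C S =
     (if even l then
        (if even m then (\<Sum>k = 0..l div 2. a k * C (2 * k))
         else (\<Sum>k = 1..l div 2. a k * S (2 * k)))
      else
        (if even m then (\<Sum>k = 1..(l + 1) div 2. a k * C (2 * k - 1))
         else (\<Sum>k = 1..(l + 1) div 2. a k * S (2 * k - 1))))"

definition trig_coeffs :: "(nat \<Rightarrow> int \<Rightarrow> nat \<Rightarrow> real) \<Rightarrow> bool" where
  "trig_coeffs A \<longleftrightarrow> (\<forall>l m. \<bar>m\<bar> \<le> int l \<longrightarrow> (\<forall>\<theta>\<in>{0..pi}.
     Phat l m (cos \<theta>) =
       trig_sum l m (A l m) (\<lambda>k. cos (real k * \<theta>)) (\<lambda>k. sin (real k * \<theta>))))"


definition lgl_points :: "nat \<Rightarrow> (nat \<Rightarrow> real) \<Rightarrow> bool" where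
  "lgl_points N x \<longleftrightarrow>
     bij_betw x {0..N} {y. (1 - y\<^sup>2) * poly (pderiv (legendre N)) y = 0}"

definition lagrange_basis :: "nat \<Rightarrow> (nat \<Rightarrow> real) \<Rightarrow> nat \<Rightarrow> real poly" where
  "lagrange_basis N x i = (\<Prod>j\<in>{0..N} - {i}. smult (1 / (x i - x j)) [:- x j, 1:])"

definition lagrange_legendre_coeffs :: "nat \<Rightarrow> (nat \<Rightarrow> real) \<Rightarrow> (nat \<Rightarrow> nat \<Rightarrow> real) \<Rightarrow> bool" where
  "lagrange_legendre_coeffs N x v \<longleftrightarrow>
     (\<forall>i\<in>{0..N}. lagrange_basis N x i = (\<Sum>n = 0..N. smult (v i n) (legendre n)))"

definition psi :: "nat \<Rightarrow> (nat \<Rightarrow> real) \<Rightarrow> nat \<Rightarrow> nat \<Rightarrow> real \<times> real \<Rightarrow> real" where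
  "psi N x i j = (\<lambda>(\<eta>, \<xi>). poly (lagrange_basis N x i) \<xi> * poly (lagrange_basis N x j) \<eta>)"


text \<open>Half-width and midpoint of the \<open>k\<close>-th interval \<open>[g (k - 1), g k]\<close>, for \<open>k \<ge> 1\<close>.\<close>

definition half :: "(nat \<Rightarrow> real) \<Rightarrow> nat \<Rightarrow> real" where
  "half g k = (g k - g (k - 1)) / 2"

definition mid :: "(nat \<Rightarrow> real) \<Rightarrow> nat \<Rightarrow> real" where
  "mid g k = (g (k - 1) + g k) / 2"

definition rect :: "(nat \<Rightarrow> real) \<Rightarrow> (nat \<Rightarrow> real) \<Rightarrow> nat \<Rightarrow> nat \<Rightarrow> (real \<times> real) set" where
  "rect th ph s t = {th (s - 1)..th s} \<times> {ph (t - 1)..ph t}"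

definition elem_map :: "(nat \<Rightarrow> real) \<Rightarrow> (nat \<Rightarrow> real) \<Rightarrow> nat \<Rightarrow> nat \<Rightarrow> real \<times> real \<Rightarrow> real \<times> real" where
  "elem_map th ph s t = (\<lambda>(\<eta>, \<xi>). (half th s * \<eta> + mid th s, half ph t * \<xi> + mid ph t))"

definition elem_map_inv :: "(nat \<Rightarrow> real) \<Rightarrow> (nat \<Rightarrow> real) \<Rightarrow> nat \<Rightarrow> nat \<Rightarrow> real \<times> real \<Rightarrow> real \<times> real" where
  "elem_map_inv th ph s t = inv_into ({-1..1} \<times> {-1..1}) (elem_map th ph s t)"

text \<open>Element \<open>e\<close> is \<open>rect th ph (s e) (t e)\<close>. The sequences \<open>th\<close>, \<open>ph\<close> need not be monotone, so any
  finite non-overlapping family of nondegenerate coordinate rectangles can be described.\<close>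

definition element_partition ::
  "nat \<Rightarrow> (nat \<Rightarrow> real) \<Rightarrow> (nat \<Rightarrow> real) \<Rightarrow> (nat \<Rightarrow> nat) \<Rightarrow> (nat \<Rightarrow> nat) \<Rightarrow> bool" where
  "element_partition E th ph s t \<longleftrightarrow>
     (\<forall>e\<in>{1..E}. 1 \<le> s e \<and> 1 \<le> t e \<and> th (s e - 1) < th (s e) \<and> ph (t e - 1) < ph (t e)) \<and>
     inj_on (\<lambda>e. rect th ph (s e) (t e)) {1..E} \<and>
     (\<lambda>e. rect th ph (s e) (t e)) ` {1..E} division_of cbox (0, 0) (pi, 2 * pi)"

text \<open>The interpolation formula is imposed on the interiors of the elements only: the nodal values
  are arbitrary, so the formulas of neighbouring elements may disagree on a common edge.\<close>

definition piecewise_interpolant ::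
  "nat \<Rightarrow> (nat \<Rightarrow> real) \<Rightarrow> nat \<Rightarrow> (nat \<Rightarrow> real) \<Rightarrow> (nat \<Rightarrow> real) \<Rightarrow> (nat \<Rightarrow> nat) \<Rightarrow> (nat \<Rightarrow> nat)
    \<Rightarrow> (nat \<Rightarrow> nat \<Rightarrow> nat \<Rightarrow> complex) \<Rightarrow> (real \<Rightarrow> real \<Rightarrow> complex) \<Rightarrow> bool" where
  "piecewise_interpolant N x E th ph s t U u \<longleftrightarrow>
     (\<forall>e\<in>{1..E}. \<forall>(\<theta>, \<phi>)\<in>interior (rect th ph (s e) (t e)).
        u \<theta> \<phi> = (\<Sum>i = 0..N. \<Sum>j = 0..N.
          U e i j * of_real (psi N x i j (elem_map_inv th ph (s e) (t e) (\<theta>, \<phi>)))))"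


definition coef_a :: "nat \<Rightarrow> (nat \<Rightarrow> nat \<Rightarrow> real) \<Rightarrow> (nat \<Rightarrow> real) \<Rightarrow> int \<Rightarrow> nat \<Rightarrow> nat \<Rightarrow> complex" where
  "coef_a N v ph m i t =
     (if m = 0 then
        2 * of_real (v i 0) * of_real (half ph t) * exp (- \<i> * of_int m * of_real (mid ph t))
      else
        of_real (half ph t) * exp (- \<i> * of_int m * of_real (mid ph t))
        * (\<Sum>n = 0..N. 2 * (\<i> powi (- int n)) * of_real (v i n)
              * of_real (sph_bessel n (of_int m * half ph t))))"

definition coef_b :: "nat \<Rightarrow> (nat \<Rightarrow> nat \<Rightarrow> real) \<Rightarrow> (nat \<Rightarrow> real) \<Rightarrow> nat \<Rightarrow> int \<Rightarrow> nat \<Rightarrow> nat \<Rightarrow> real" where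
  "coef_b N v th l m j s =
     half th s * (\<Sum>n = 0..N. v j n * calQ n l m (half th s) (mid th s))"

definition coef_c :: "nat \<Rightarrow> (nat \<Rightarrow> nat \<Rightarrow> real) \<Rightarrow> (nat \<Rightarrow> real) \<Rightarrow> nat \<Rightarrow> int \<Rightarrow> nat \<Rightarrow> nat \<Rightarrow> real" where
  "coef_c N v th l m j s =
     half th s * (\<Sum>n = 0..N. v j n * calP n l m (half th s) (mid th s))"

definition ctilde1 :: "nat \<Rightarrow> int \<Rightarrow> real" where
  "ctilde1 l m = 1 / 2 * sqrt (of_int ((int l + m) * (int l - m + 1)))"

definition ctilde2 :: "nat \<Rightarrow> int \<Rightarrow> real" where
  "ctilde2 l m = 1 / 2 * sqrt (of_int ((int l + m + 1) * (int l - m)))"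

definition coef_d_nonneg ::
  "nat \<Rightarrow> (nat \<Rightarrow> nat \<Rightarrow> real) \<Rightarrow> (nat \<Rightarrow> real) \<Rightarrow> nat \<Rightarrow> int \<Rightarrow> nat \<Rightarrow> nat \<Rightarrow> real" where
  "coef_d_nonneg N v th l m j s =
     (if m = 0 then - sqrt (real (l * (l + 1))) * coef_b N v th l 1 j s
      else if m = int l then sqrt (real l / 2) * coef_b N v th l (int l - 1) j s
      else ctilde1 l m * coef_b N v th l (m - 1) j s - ctilde2 l m * coef_b N v th l (m + 1) j s)"

definition coef_d :: "nat \<Rightarrow> (nat \<Rightarrow> nat \<Rightarrow> real) \<Rightarrow> (nat \<Rightarrow> real) \<Rightarrow> nat \<Rightarrow> int \<Rightarrow> nat \<Rightarrow> nat \<Rightarrow> real" where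
  "coef_d N v th l m j s =
     (if m \<ge> 0 then coef_d_nonneg N v th l m j s
      else (-1) ^ nat (- m) * coef_d_nonneg N v th l (- m) j s)"

end

theory Submission
  imports Defs
begin

text \<open>
  On the interior of an element each integrand is a sum of products of a function of \<open>\<theta>\<close> and a
  function of \<open>\<phi>\<close>, so by Fubini and an affine substitution everything reduces to integrals of
  Legendre polynomials. The azimuthal factors are Fourier transforms of Legendre polynomials: by
  Rodrigues' formula and integration by parts the moments of \<open>P\<^sub>n\<close> are Beta integrals, and summing
  the exponential series turns them into the power series of \<open>j\<^sub>n\<close>. In the polar direction the factor
  \<open>sin \<theta>\<close> of the surface measure cancels \<open>1 / sin \<theta>\<close> in the azimuthal derivative, and
  the polar derivative of \<open>Phat l m (cos \<theta>)\<close> is a combination of the orders \<open>m - 1\<close> and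
  \<open>m + 1\<close>, because the \<open>(m - 1)\<close>-fold derivative of Legendre's equation eliminates the term
  \<open>cos \<theta>\<close> times the order-\<open>m\<close> function. The trigonometric expansions extend from \<open>[0, \<pi>]\<close> to the
  real line by parity and periodicity.
\<close>

section \<open>Legendre moments and spherical Bessel functions\<close>

lemma poly_pderiv_has_integral:
  fixes p :: "real poly"
  assumes "a \<le> b"
  shows "((\<lambda>x. poly (pderiv p) x) has_integral (poly p b - poly p a)) {a..b}"
  using assms
  by (intro fundamental_theorem_of_calculus)
     (auto simp: has_real_derivative_iff_has_vector_derivative[symmetric]
           intro: DERIV_subset[OF poly_DERIV])

lemma poly_integrable_on [simp]: "(\<lambda>x. poly p x) integrable_on {a..b}" for p :: "real poly"
  by (intro integrable_continuous_real continuous_intros)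

lemma integral_poly_smult:
  fixes p :: "real poly"
  shows "integral S (\<lambda>x. poly (smult c p) x) = c * integral S (\<lambda>x. poly p x)"
  by simp

lemma integral_poly_by_parts:
  fixes p q :: "real poly"
  assumes "a \<le> b" and "poly (p * q) a = poly (p * q) b"
  shows "integral {a..b} (\<lambda>x. poly (pderiv p * q) x) = - integral {a..b} (\<lambda>x. poly (p * pderiv q) x)"
proof -
  have "integral {a..b} (\<lambda>x. poly (pderiv (p * q)) x) = 0"
    using poly_pderiv_has_integral[OF assms(1), of "p * q"] assms(2)
    by (simp add: integral_unique)
  also have "(\<lambda>x. poly (pderiv (p * q)) x) = (\<lambda>x. poly (pderiv p * q) x + poly (p * pderiv q) x)"
    by (simp add: fun_eq_iff pderiv_mult algebra_simps)
  finally show ?thesis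
    by (simp add: integral_add del: poly_mult)
qed

text \<open>One differentiation lowers the power of \<open>p\<close> that divides a polynomial by at
  most one. For \<open>k < n\<close> this makes the k-th derivative of \<open>(x^2 - 1)^n\<close>
  vanish at both ends of [-1, 1], which removes the boundary terms in the integrations by parts
  below.\<close>

lemma power_dvd_higher_pderiv_power:
  fixes p :: "real poly"
  shows "k \<le> n \<Longrightarrow> p ^ (n - k) dvd (pderiv ^^ k) (p ^ n)"
proof (induction k)
  case 0
  then show ?case by simp
next
  case (Suc k)
  define j where "j = n - Suc k"
  have "n - k = Suc j" using Suc.prems by (simp add: j_def)
  with Suc obtain q where q: "(pderiv ^^ k) (p ^ n) = p ^ Suc j * q"
    by (auto elim!: dvdE)
  have "(pderiv ^^ Suc k) (p ^ n) = p ^ j * (p * pderiv q + q * smult (of_nat (Suc j)) (pderiv p))"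
    by (simp only: funpow.simps o_apply q pderiv_mult pderiv_power_Suc)
       (simp add: algebra_simps)
  then show ?case by (simp add: j_def)
qed

text \<open>Integration by parts, \<open>k\<close> times. With \<open>k = n\<close> all derivatives
  in Rodrigues' formula move from the weight to \<open>q\<close>.\<close>

lemma integral_higher_pderiv_swap:
  fixes q :: "real poly"
  assumes "k \<le> n"
  defines "w \<equiv> [:-1, 0, 1:] ^ n :: real poly"
  shows "integral {-1..1} (\<lambda>x. poly ((pderiv ^^ k) w * q) x)
       = (-1) ^ k * integral {-1..1} (\<lambda>x. poly (w * (pderiv ^^ k) q) x)"
  using assms(1)
proof (induction k arbitrary: q)
  case 0
  then show ?case by simp
next
  case (Suc k)
  \<comment> \<open>\<open>Suc k \<le> n\<close> leaves at least one factor \<open>x^2 - 1\<close>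
    in the k-th derivative, so both boundary values are 0.\<close>
  have "[:-1, 0, 1:] dvd (pderiv ^^ k) w"
    using power_dvd_higher_pderiv_power[of k n "[:-1, 0, 1:]"] Suc.prems unfolding w_def
    by (metis Suc_diff_le Suc_le_mono dvd_power dvd_trans le_Suc_eq not_less_eq_eq zero_less_diff Suc_le_eq)
  then obtain r where "(pderiv ^^ k) w = [:-1, 0, 1:] * r" by (elim dvdE)
  then have "poly ((pderiv ^^ k) w * q) (-1) = poly ((pderiv ^^ k) w * q) 1" by simp
  from integral_poly_by_parts[OF _ this]
  have "integral {-1..1} (\<lambda>x. poly ((pderiv ^^ Suc k) w * q) x)
      = - integral {-1..1} (\<lambda>x. poly ((pderiv ^^ k) w * pderiv q) x)"
    by simp
  also have "\<dots> = - ((-1) ^ k * integral {-1..1} (\<lambda>x. poly (w * (pderiv ^^ k) (pderiv q)) x))"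
    using Suc by simp
  also have "(pderiv ^^ k) (pderiv q) = (pderiv ^^ Suc k) q"
    by (simp add: funpow_swap1)
  finally show ?case by simp
qed

lemma higher_pderiv_monom_fact:
  "(pderiv ^^ k) (monom (1 :: real) (k + r)) = monom (fact (k + r) / fact r) r"
proof (induction k arbitrary: r)
  case (Suc k)
  have "(pderiv ^^ Suc k) (monom (1 :: real) (Suc k + r)) = pderiv ((pderiv ^^ k) (monom 1 (k + Suc r)))"
    by simp
  also have "\<dots> = monom (fact (Suc k + r) / fact r) r"
    unfolding Suc by (simp add: pderiv_monom del: of_nat_Suc)
  finally show ?case .
qed auto

lemma integral_weight_odd_power:
  assumes "odd r"
  shows "integral {-1..1} (\<lambda>x. poly ([:-1, 0, 1:] ^ n * monom 1 r) x) = (0 :: real)" (is "integral _ ?f = 0")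
proof -
  have "integral {-1..1} ?f = integral {-1..1} (\<lambda>x. ?f (- x))"
    using Henstock_Kurzweil_Integration.integral_reflect_real[of 1 "-1" ?f] by simp
  also have "\<dots> = - integral {-1..1} ?f"
    using assms by (simp add: poly_monom)
  finally show ?thesis by simp
qed

text \<open>Up to the sign this is the Beta integral \<open>B(k + 1/2, n + 1)\<close>, its
  half-integer Gamma values written through factorials. In the induction on \<open>n\<close>,
  integration by parts trades a factor \<open>x^2 - 1\<close> for a factor \<open>x^2\<close>; hence
  \<open>k\<close> is arbitrary.\<close>

lemma integral_weight_even_power:
  "integral {-1..1} (\<lambda>x. poly ([:-1, 0, 1:] ^ n * monom 1 (2 * k)) x)
     = (-1) ^ n * (2 * 4 ^ n * fact n * fact (n + k) * fact (2 * k)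
          / (fact k * fact (2 * n + 2 * k + 1)) :: real)"
proof (induction n arbitrary: k)
  case 0
  define p where "p = smult (1 / real (2 * k + 1)) (monom 1 (2 * k + 1))"
  have "pderiv p = monom 1 (2 * k)"
    by (simp add: p_def pderiv_smult pderiv_monom smult_monom del: of_nat_Suc)
  then have "((\<lambda>x. poly (monom 1 (2 * k)) x) has_integral (poly p 1 - poly p (-1))) {-1..1}"
    using poly_pderiv_has_integral[of "-1" 1 p] by simp
  then have "integral {-1..1} (\<lambda>x. poly (monom 1 (2 * k)) x) = 2 / real (2 * k + 1)"
    by (simp add: p_def integral_unique poly_monom)
  moreover have "fact (2 * k + 1) = real (2 * k + 1) * fact (2 * k)" by simp
  ultimately show ?case by (simp del: of_nat_Suc fact_Suc)
next
  case (Suc n)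
  define p where "p = smult (1 / real (2 * k + 1)) (monom 1 (2 * k + 1))"
  define w where "w = [:-1, 0, 1 :: real:]"
  have p': "pderiv p = monom 1 (2 * k)"
    by (simp add: p_def pderiv_smult pderiv_monom smult_monom del: of_nat_Suc)
  have w': "pderiv w = monom 2 1"
    by (simp add: w_def pderiv_pCons monom_altdef)
  have "integral {-1..1} (\<lambda>x. poly (w ^ Suc n * monom 1 (2 * k)) x)
      = integral {-1..1} (\<lambda>x. poly (pderiv p * w ^ Suc n) x)"
    by (simp only: p' mult.commute)
  also have "\<dots> = - integral {-1..1} (\<lambda>x. poly (p * pderiv (w ^ Suc n)) x)"
    by (rule integral_poly_by_parts) (auto simp: w_def)
  also have "p * pderiv (w ^ Suc n)
      = smult (2 * real (n + 1) / real (2 * k + 1)) (w ^ n * monom 1 (2 * Suc k))"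
  proof -
    have "monom (1::real) (2 * Suc k) = monom 1 (2 * k + 1) * monom 1 1"
      by (simp add: mult_monom)
    moreover have "monom (2::real) 1 = smult 2 (monom 1 1)"
      by (simp add: smult_monom)
    ultimately show ?thesis
      unfolding pderiv_power_Suc w' p_def by (simp add: algebra_simps)
  qed
  also have "integral {-1..1} (\<lambda>x. poly \<dots> x) = 2 * real (n + 1) / real (2 * k + 1)
      * integral {-1..1} (\<lambda>x. poly (w ^ n * monom 1 (2 * Suc k)) x)"
    by (simp del: poly_mult)
  finally have rec: "integral {-1..1} (\<lambda>x. poly (w ^ Suc n * monom 1 (2 * k)) x)
      = - (2 * real (n + 1) / real (2 * k + 1)
          * integral {-1..1} (\<lambda>x. poly (w ^ n * monom 1 (2 * Suc k)) x))" .
  have f: "fact (2 * Suc k) = 2 * (real k + 1) * (2 * real k + 1) * fact (2 * k)"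
    "fact (Suc k) = (real k + 1) * fact k" "fact (Suc n) = (real n + 1) * fact n"
    by (simp_all add: algebra_simps)
  have idx: "n + Suc k = Suc n + k" "2 * n + 2 * Suc k + 1 = 2 * Suc n + 2 * k + 1"
    "real (n + 1) = real n + 1" "real (2 * k + 1) = 2 * real k + 1"
    by simp_all
  \<comment> \<open>The factorials common to both sides enter as variables; what remains is to
    cancel \<open>real k + 1\<close> and \<open>2 * real k + 1\<close>.\<close>
  have g: "- ((2 * (real n + 1) / (2 * real k + 1)) * (a * (2 * 4 ^ n * H * M
              * (2 * (real k + 1) * (2 * real k + 1) * F) / ((real k + 1) * K * G))))
       = (-1 * a) * (2 * (4 * 4 ^ n) * ((real n + 1) * H) * M * F / (K * G))"
    for a M F G H K :: real
  proof -
    have "real k + 1 \<noteq> 0" "2 * real k + 1 \<noteq> 0" by linarith+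
    then show ?thesis
      by (simp add: divide_eq_eq eq_divide_eq) (simp add: algebra_simps)
  qed
  show ?case
    unfolding w_def[symmetric] rec unfolding w_def Suc.IH idx f power_Suc by (rule g)
qed

text \<open>Moving the derivatives of Rodrigues' formula onto \<open>x^j\<close> leaves 0 or a
  weighted integral of a monomial of degree \<open>j - n\<close>. The guard \<open>n \<le> j\<close>
  matters because natural subtraction truncates: \<open>even (j - n)\<close> also holds for
  \<open>j < n\<close>.\<close>

lemma legendre_moment:
  "integral {-1..1} (\<lambda>x. poly (legendre n * monom 1 j) x) =
     (if n \<le> j \<and> even (j - n)
      then 2 * (2 ^ n * fact (n + (j - n) div 2) * fact j
                 / (fact ((j - n) div 2) * fact (n + j + 1)))
      else 0)"
proof -
  define w where "w = [:-1, 0, 1 :: real:]"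
  have *: "integral {-1..1} (\<lambda>x. poly (legendre n * monom 1 j) x)
     = (-1) ^ n / (2 ^ n * fact n) * integral {-1..1} (\<lambda>x. poly (w ^ n * (pderiv ^^ n) (monom 1 j)) x)"
    using integral_higher_pderiv_swap[of n n "monom 1 j"]
    by (simp add: legendre_def w_def mult.assoc)
  show ?thesis
  proof (cases "n \<le> j")
    case False
    then have "(pderiv ^^ n) (monom (1::real) j) = 0"
      by (intro poly_eqI) (simp add: coeff_higher_pderiv)
    with * False show ?thesis by simp
  next
    case True
    define r where "r = j - n"
    have j: "j = n + r" using True by (simp add: r_def)
    have d: "(pderiv ^^ n) (monom (1::real) j) = smult (fact j / fact r) (monom 1 r)"
      unfolding j higher_pderiv_monom_fact by (simp add: smult_monom)
    have **: "integral {-1..1} (\<lambda>x. poly (legendre n * monom 1 j) x)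
     = (-1) ^ n / (2 ^ n * fact n) * (fact j / fact r) * integral {-1..1} (\<lambda>x. poly (w ^ n * monom 1 r) x)"
      unfolding * d mult_smult_right integral_poly_smult by (simp only: times_divide_eq_left mult.assoc times_divide_eq_right)
    show ?thesis
    proof (cases "even r")
      case False
      with ** show ?thesis
        by (simp add: integral_weight_odd_power w_def r_def del: poly_mult)
    next
      case True
      then obtain k where k: "r = 2 * k" by (elim evenE)
      have s: "(-1) ^ n * (-1) ^ n = (1::real)" by (simp flip: power_mult_distrib)
      have e: "n + j + 1 = 2 * n + 2 * k + 1" by (simp add: j k)
      have "(4::real) ^ n = 2 ^ n * 2 ^ n" by (simp flip: power_mult_distrib)
      then show ?thesis
        unfolding ** k w_def integral_weight_even_power using True
        by (simp add: s j k r_def[symmetric] algebra_simps del: fact_Suc)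
    qed
  qed
qed

section \<open>The Fourier transform of the Legendre polynomials\<close>

lemma legendre_exp_sums:
  fixes z :: real
  shows "(\<lambda>k. (\<i> * of_real z) ^ k / fact k * of_real (integral {-1..1} (\<lambda>x. poly (legendre n * monom 1 k) x)))
         sums integral {-1..1} (\<lambda>x. of_real (poly (legendre n) x) * exp (\<i> * of_real z * of_real x))"
proof -
  define f :: "nat \<Rightarrow> real \<Rightarrow> complex" where
    "f = (\<lambda>k x. of_real (poly (legendre n * monom 1 k) x) * ((\<i> * of_real z) ^ k / fact k))"
  \<comment> \<open>Compactness bounds the polynomial by some \<open>C\<close>; with
    \<open>\<bar>x\<bar> \<le> 1\<close> this gives the majorant
    \<open>C * \<bar>z\<bar>^k / k!\<close>.\<close>
  have "bounded ((\<lambda>x. poly (legendre n) x) ` {-1..1})"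
    by (intro compact_imp_bounded compact_continuous_image continuous_intros) auto
  then obtain C where C: "\<bar>poly (legendre n) x\<bar> \<le> C" if "x \<in> {-1..1}" for x
    by (metis bounded_iff image_eqI real_norm_def)
  have "C \<ge> 0" using C[of 0] by simp
  have bound: "norm (f k x) \<le> C * (\<bar>z\<bar> ^ k / fact k)" if "x \<in> {-1..1}" for k x
  proof -
    have "\<bar>x\<bar> ^ k \<le> 1" using that by (intro power_le_one) auto
    with C[OF that] \<open>C \<ge> 0\<close> have "\<bar>poly (legendre n) x\<bar> * \<bar>x\<bar> ^ k \<le> C * 1"
      by (intro mult_mono) auto
    then show ?thesis
      by (simp add: f_def poly_monom norm_mult norm_divide norm_power power_abs abs_mult
            divide_right_mono mult_right_mono)
  qed
  have "summable (\<lambda>k. C * (\<bar>z\<bar> ^ k / fact k))"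
    using summable_exp[of "\<bar>z\<bar>"] by (intro summable_mult) (simp add: field_simps)
  \<comment> \<open>The M-test makes the exponential series converge uniformly on [-1, 1], so it may
    be integrated term by term.\<close>
  with bound have "uniform_limit {-1..1} (\<lambda>K x. \<Sum>k<K. f k x) (\<lambda>x. \<Sum>k. f k x) sequentially"
    by (rule Weierstrass_m_test)
  moreover have "continuous_on {-1..1} (\<lambda>x. \<Sum>k<K. f k x)" for K
    unfolding f_def by (intro continuous_intros)
  ultimately obtain I J where IJ: "\<And>K. ((\<lambda>x. \<Sum>k<K. f k x) has_integral I K) {-1..1}"
      "((\<lambda>x. \<Sum>k. f k x) has_integral J) {-1..1}" "I \<longlonglongrightarrow> J"
    by (rule uniform_limit_integral) auto
  have "((\<lambda>x. \<Sum>k<K. f k x) has_integral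
        (\<Sum>k<K. (\<i> * of_real z) ^ k / fact k * of_real (integral {-1..1} (\<lambda>x. poly (legendre n * monom 1 k) x)))) {-1..1}" for K
    unfolding f_def
    by (subst mult.commute)
       (intro has_integral_sum has_integral_mult_left has_integral_of_real integrable_integral
          poly_integrable_on finite_lessThan)
  with IJ(1) have "I = (\<lambda>K. \<Sum>k<K. (\<i> * of_real z) ^ k / fact k
      * of_real (integral {-1..1} (\<lambda>x. poly (legendre n * monom 1 k) x)))"
    by (intro ext) (rule has_integral_unique)
  moreover have "(\<Sum>k. f k x) = of_real (poly (legendre n) x) * exp (\<i> * of_real z * of_real x)" for x
  proof -
    have "(\<lambda>k. of_real (poly (legendre n) x) * ((\<i> * of_real z * of_real x) ^ k /\<^sub>R fact k))
        sums (of_real (poly (legendre n) x) * exp (\<i> * of_real z * of_real x))"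
      by (intro sums_mult exp_converges)
    moreover have "of_real (poly (legendre n) x) * ((\<i> * of_real z * of_real x) ^ k /\<^sub>R fact k) = f k x" for k
      by (simp add: f_def poly_monom power_mult_distrib scaleR_conv_of_real field_simps)
    ultimately show ?thesis by (simp add: sums_iff)
  qed
  ultimately show ?thesis
    using IJ(2,3) by (simp add: sums_def integral_unique del: poly_mult)
qed

text \<open>Only the moments of degree \<open>n + 2 * k\<close> survive. Multiplied by
  \<open>(i z)^(n + 2k) / (n + 2k)!\<close> they become \<open>2 * i^n\<close> times the terms of
  the series of \<open>j_n\<close>, since \<open>i^(2k) = (-1)^k\<close>.\<close>

lemma legendre_exp_integral:
  fixes z :: real
  shows "integral {-1..1} (\<lambda>x. of_real (poly (legendre n) x) * exp (\<i> * of_real z * of_real x))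
     = 2 * \<i> ^ n * of_real (sph_bessel n z)"
proof -
  define c where "c = (\<lambda>k. (-1) ^ k * (2 ^ n * fact (n + k) / (fact k * fact (2 * n + 2 * k + 1))) * z ^ (n + 2 * k))"
  define J where "J = integral {-1..1} (\<lambda>x. of_real (poly (legendre n) x) * exp (\<i> * of_real z * of_real x))"
  define h where "h = (\<lambda>k. (\<i> * of_real z) ^ k / fact k
      * of_real (integral {-1..1} (\<lambda>x. poly (legendre n * monom 1 k) x)))"
  have "h sums J" unfolding h_def J_def by (rule legendre_exp_sums)
  moreover have "strict_mono (\<lambda>k. n + 2 * k)" by (intro strict_monoI) simp
  moreover have "h j = 0" if "j \<notin> range (\<lambda>k. n + 2 * k)" for j
  proof -
    have "\<not> (n \<le> j \<and> even (j - n))"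
    proof safe
      assume "n \<le> j" "even (j - n)"
      then have "j = n + 2 * ((j - n) div 2)" by simp
      with that show False by blast
    qed
    then show ?thesis unfolding h_def legendre_moment by (simp only: if_False of_real_0 mult_zero_right)
  qed
  \<comment> \<open>The zero terms are dropped by reindexing along the strictly monotone map from
    \<open>k\<close> to \<open>n + 2 * k\<close>.\<close>
  ultimately have "(\<lambda>k. h (n + 2 * k)) sums J"
    using sums_mono_reindex[of "\<lambda>k. n + 2 * k" h J] by (simp add: o_def)
  moreover have "h (n + 2 * k) = 2 * \<i> ^ n * of_real (c k)" for k
    by (simp add: h_def c_def legendre_moment power_mult_distrib power_add power_mult
             del: poly_mult fact_Suc)
  ultimately have *: "(\<lambda>k. 2 * \<i> ^ n * of_real (c k)) sums J" by simp
  \<comment> \<open>\<open>sph_bessel\<close> is a \<open>suminf\<close>, which is meaningful only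
    for a convergent series. Convergence is read off from the complex series by dividing by the
    nonzero \<open>2 * i^n\<close>.\<close>
  then have "(\<lambda>k. complex_of_real (c k)) sums (J / (2 * \<i> ^ n))"
    using sums_divide[OF *, of "2 * \<i> ^ n"] by simp
  then have "summable (\<lambda>k. complex_of_real (c k))" by (rule sums_summable)
  then have "summable c"
    by (simp add: summable_complex_of_real)
  then have s: "(\<lambda>k. complex_of_real (c k)) sums (of_real (sph_bessel n z))"
    unfolding sph_bessel_def c_def[symmetric] by (intro sums_of_real summable_sums)
  from sums_mult[OF s, of "2 * \<i> ^ n"] * have "J = 2 * \<i> ^ n * of_real (sph_bessel n z)"
    by (rule sums_unique2[symmetric])
  then show "integral {-1..1} (\<lambda>x. of_real (poly (legendre n) x) * exp (\<i> * of_real z * of_real x))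
     = 2 * \<i> ^ n * of_real (sph_bessel n z)"
    by (simp add: J_def)
qed

text \<open>The inverse of i is its conjugate. This links the \<open>i^(-n)\<close> of the
  coefficients with the \<open>i^n\<close> that the Fourier transform produces.\<close>

lemma imaginary_unit_powi_uminus: "\<i> powi (- int n) = cnj (\<i> ^ n)"
  by (simp add: power_int_minus flip: power_inverse)

lemma Re_Im_powi_uminus:
  "Re (\<i> powi (- int n)) = Re (\<i> ^ n)" "Im (\<i> powi (- int n)) = - Im (\<i> ^ n)"
  unfolding imaginary_unit_powi_uminus by (simp_all del: complex_cnj_power)

lemma legendre_exp_integral_shift:
  "integral {-1..1} (\<lambda>x. of_real (poly (legendre n) x) * cis (lam * x + \<rho>))
     = 2 * \<i> ^ n * of_real (sph_bessel n lam) * cis \<rho>"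
proof -
  have "of_real (poly (legendre n) x) * cis (lam * x + \<rho>)
     = of_real (poly (legendre n) x) * exp (\<i> * of_real lam * of_real x) * cis \<rho>" for x
    by (simp add: cis_conv_exp exp_add algebra_simps)
  then have "integral {-1..1} (\<lambda>x. of_real (poly (legendre n) x) * cis (lam * x + \<rho>))
     = integral {-1..1} (\<lambda>x. of_real (poly (legendre n) x) * exp (\<i> * of_real lam * of_real x) * cis \<rho>)"
    by presburger
  then show ?thesis
    by (simp only: Henstock_Kurzweil_Integration.integral_mult_left legendre_exp_integral)
qed

lemma sph_bessel_0: "sph_bessel n (0::real) = (if n = 0 then 1 else 0)"
proof -
  have "sph_bessel n (0::real) = (\<Sum>k\<in>{0}. (if n = 0 then 1 else 0))"
    unfolding sph_bessel_def by (subst suminf_finite[of "{0}"]) auto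
  then show ?thesis by simp
qed

lemma calC_eq: "calC n lam \<rho> = Re (2 * \<i> ^ n * of_real (sph_bessel n lam) * cis \<rho>)"
  and calS_eq: "calS n lam \<rho> = Im (2 * \<i> ^ n * of_real (sph_bessel n lam) * cis \<rho>)"
proof -
  define f where "f = (\<lambda>x. of_real (poly (legendre n) x) * cis (lam * x + \<rho>))"
  have "f integrable_on {-1..1}"
    unfolding f_def by (intro integrable_continuous_real continuous_intros)
  then have "(f has_integral 2 * \<i> ^ n * of_real (sph_bessel n lam) * cis \<rho>) {-1..1}"
    using legendre_exp_integral_shift by (simp add: has_integral_iff f_def)
  from has_integral_Re[OF this] has_integral_Im[OF this]
  show "calC n lam \<rho> = Re (2 * \<i> ^ n * of_real (sph_bessel n lam) * cis \<rho>)"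
   and "calS n lam \<rho> = Im (2 * \<i> ^ n * of_real (sph_bessel n lam) * cis \<rho>)"
    unfolding calC_def calS_def
    by (simp_all add: f_def integral_unique)
qed

text \<open>Real and imaginary parts of the shifted transform. The case \<open>lam = 0\<close> is
  included, because \<open>j_n(0)\<close> is 1 for \<open>n = 0\<close> and 0 otherwise.\<close>

lemma calC_bessel: "calC n lam \<rho> =
           (if lam = 0 then 2 * (if n = 0 then 1 else 0) * cos \<rho>
            else 2 * sph_bessel n lam *
                   (Re (\<i> powi (- int n)) * cos \<rho> + Im (\<i> powi (- int n)) * sin \<rho>))"
  and calS_bessel: "calS n lam \<rho> =
           (if lam = 0 then 2 * (if n = 0 then 1 else 0) * sin \<rho>
            else 2 * sph_bessel n lam *
                   (Re (\<i> powi (- int n)) * sin \<rho> - Im (\<i> powi (- int n)) * cos \<rho>))"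
  by (auto simp: calC_eq calS_eq sph_bessel_0 Re_Im_powi_uminus algebra_simps)

section \<open>The polar derivative of the associated Legendre functions\<close>

text \<open>\<open>w = (x^2 - 1)^l\<close> solves \<open>(x^2 - 1) w' = 2 l x w\<close>; this is the
  r-th derivative of that equation by Leibniz' rule. The induction differentiates once more in each
  step, starting from \<open>r = 1\<close>.\<close>

lemma higher_pderiv_weight_recurrence:
  fixes l r :: nat
  defines "A \<equiv> [:-1, 0, 1:] :: real poly" and "X \<equiv> [:0, 1:] :: real poly"
  assumes "r \<ge> 1"
  shows "A * (pderiv ^^ (r + 1)) (A ^ l) + smult (2 * (real r - real l)) (X * (pderiv ^^ r) (A ^ l))
     + smult (real r * (real r - 1 - 2 * real l)) ((pderiv ^^ (r - 1)) (A ^ l)) = 0"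
proof -
  define w where "w = A ^ l"
  have A: "pderiv A = smult 2 X" and X: "pderiv X = 1"
    by (simp_all add: A_def X_def pderiv_pCons)
  note expand = algebra_simps smult_add_left smult_diff_left smult_add_right smult_diff_right
  have 0: "A * pderiv w = smult (2 * real l) (X * w)"
  proof (cases l)
    case (Suc n)
    show ?thesis
      unfolding w_def Suc pderiv_power_Suc A by (simp add: algebra_simps)
  qed (simp add: w_def)
  have "A * (pderiv ^^ (r + 1)) w + smult (2 * (real r - real l)) (X * (pderiv ^^ r) w)
     + smult (real r * (real r - 1 - 2 * real l)) ((pderiv ^^ (r - 1)) w) = 0"
    using \<open>r \<ge> 1\<close>
  proof (induction r rule: nat_induct_at_least)
    case base
    have "pderiv (A * pderiv w - smult (2 * real l) (X * w)) = 0"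
      using 0 by simp
    then show ?case
      unfolding pderiv_diff pderiv_mult pderiv_smult A X by (simp add: expand)
  next
    case (Suc r)
    define s where "s = r - 1"
    have r: "r = Suc s" using Suc by (simp add: s_def)
    define u where "u = (pderiv ^^ s) w"
    have "pderiv (A * (pderiv ^^ (r + 1)) w
        + smult (2 * (real r - real l)) (X * (pderiv ^^ r) w)
        + smult (real r * (real r - 1 - 2 * real l)) ((pderiv ^^ (r - 1)) w)) = 0"
      by (simp only: Suc.IH pderiv_0)
    \<comment> \<open>Passing to values at a point turns the identity of polynomials into one of
      real numbers, where like terms can be collected.\<close>
    then have "poly (A * pderiv (pderiv (pderiv u)) + smult 2 (X * pderiv (pderiv u))
        + smult (2 * (real r - real l)) (X * pderiv (pderiv u) + pderiv u)
        + smult (real r * (real r - 1 - 2 * real l)) (pderiv u)) y = 0" for y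
      unfolding pderiv_add pderiv_mult pderiv_smult A X by (simp add: r u_def algebra_simps)
    then have "poly (A * pderiv (pderiv (pderiv u)) + smult (2 * (real (Suc r) - real l)) (X * pderiv (pderiv u))
        + smult (real (Suc r) * (real (Suc r) - 1 - 2 * real l)) (pderiv u)) y = poly 0 y" for y
      by (simp add: algebra_simps)
    then show ?case
      unfolding poly_eq_poly_eq_iff[symmetric] by (simp add: r u_def fun_eq_iff)
  qed
  then show ?thesis by (simp add: w_def)
qed

lemma higher_pderiv_legendre:
  "(pderiv ^^ m) (legendre l) = smult (1 / (2 ^ l * fact l)) ((pderiv ^^ (l + m)) ([:-1, 0, 1:] ^ l))"
  by (simp add: legendre_def higher_pderiv_smult funpow_add[of m l] add.commute[of l m])

text \<open>The recurrence at \<open>r = l + m\<close>, since \<open>P_l\<close> is a multiple of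
  the l-th derivative of the weight. For \<open>m = 1\<close> it is Legendre's differential
  equation, in general the derivative of order \<open>m - 1\<close> of that equation.\<close>

lemma assoc_legendre_ode:
  assumes "m \<ge> 1"
  shows "(x\<^sup>2 - 1) * poly ((pderiv ^^ (m + 1)) (legendre l)) x + 2 * real m * x * poly ((pderiv ^^ m) (legendre l)) x
     = (real l + real m) * (real l - real m + 1) * poly ((pderiv ^^ (m - 1)) (legendre l)) x"
proof -
  define d where "d = (\<lambda>k. poly ((pderiv ^^ k) ([:-1, 0, 1:] ^ l)) x)"
  have "poly ([:-1, 0, 1:] * (pderiv ^^ (l + m + 1)) ([:-1, 0, 1:] ^ l)
     + smult (2 * (real (l + m) - real l)) ([:0, 1:] * (pderiv ^^ (l + m)) ([:-1, 0, 1:] ^ l))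
     + smult (real (l + m) * (real (l + m) - 1 - 2 * real l)) ((pderiv ^^ (l + m - 1)) ([:-1, 0, 1:] ^ l))) x = 0"
    using higher_pderiv_weight_recurrence[of "l + m" l] assms by (simp only: poly_0)
  then have "(x\<^sup>2 - 1) * d (l + m + 1) + 2 * real m * x * d (l + m)
      = (real l + real m) * (real l - real m + 1) * d (l + m - 1)"
    by (simp add: d_def power2_eq_square algebra_simps)
  then have "c * ((x\<^sup>2 - 1) * d (l + m + 1) + 2 * real m * x * d (l + m))
      = c * ((real l + real m) * (real l - real m + 1) * d (l + m - 1))" for c
    by simp
  moreover obtain c where "poly ((pderiv ^^ k) (legendre l)) x = c * d (l + k)" for k
    by (simp add: higher_pderiv_legendre d_def that[of "1 / (2 ^ l * fact l)"])
  moreover have "l + (m - 1) = l + m - 1" "l + (m + 1) = l + m + 1" using assms by simp_all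
  ultimately show ?thesis
    by (simp only: mult.left_commute[of _ c] distrib_left[of c, symmetric])
qed

text \<open>The weight has degree \<open>2 * l\<close> and is differentiated \<open>l + m\<close>
  times.\<close>

lemma higher_pderiv_legendre_eq_0: "m > l \<Longrightarrow> (pderiv ^^ m) (legendre l) = 0"
  unfolding higher_pderiv_legendre
  by (intro poly_eqI) 
     (simp add: coeff_higher_pderiv coeff_eq_0 degree_power_eq)

section \<open>Normalised functions and their polar derivative\<close>

lemma norm_const_step:
  assumes "m < l"
  shows "norm_const l (int m) = sqrt ((real l - real m) * (real l + real m + 1)) * norm_const l (int m + 1)"
proof -
  obtain k where l: "l = Suc (m + k)"
    using assms less_iff_Suc_add by blast
  have "nat (int l - int m) = Suc k" "nat (int l + int m) = l + m" 
    "nat (int l - (int m + 1)) = k" "nat (int l + (int m + 1)) = Suc (l + m)"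
    using l by auto
  moreover have "real l - real m = real k + 1" using l by simp
  \<comment> \<open>In the quotient of the radicands each factorial shifts by one, which leaves
    \<open>(l - m) (l + m + 1)\<close>.\<close>
  ultimately show ?thesis
    unfolding norm_const_def real_sqrt_mult[symmetric]
    by (intro arg_cong[where f = sqrt]) (simp add: divide_simps add.commute add.left_commute)
qed

lemma Phat_of_nat:
  "Phat l (int m) x = norm_const l (int m) * sqrt (1 - x\<^sup>2) ^ m * poly ((pderiv ^^ m) (legendre l)) x"
  by (simp add: Phat_def assoc_legendre_def assoc_legendre_nonneg_def flip: power_mult_distrib)

text \<open>The quotient of factorials that defines negative orders is written as the root of its
  square; under the root it swaps the two factorials in the normalisation of order
  \<open>- m\<close>. Of the signs, one \<open>(-1)^m\<close> remains.\<close>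

lemma Phat_uminus:
  assumes "0 \<le> m" "m \<le> int l"
  shows "Phat l (- m) x = (-1) ^ nat m * Phat l m x"
proof (cases "m = 0")
  case False
  define k where "k = nat m"
  have k: "m = int k" "k > 0" "k \<le> l" using assms False by (auto simp: k_def)
  have "norm_const l (- int k) * (fact (l - k) / fact (l + k)) = norm_const l (int k)"
  proof -
    have n: "nat (int l - - int k) = l + k" "nat (int l + - int k) = l - k"
      "nat (int l - int k) = l - k" "nat (int l + int k) = l + k"
      using k by auto
    have "fact (l - k) / fact (l + k) = sqrt ((fact (l - k) / fact (l + k)) * (fact (l - k) / fact (l + k)))"
      unfolding real_sqrt_abs2 by simp
    then show ?thesis
      unfolding norm_const_def n
      by (subst \<open>fact (l - k) / fact (l + k) = _\<close>, unfold real_sqrt_mult[symmetric])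
         (simp add: field_simps)
  qed
  from this[symmetric] k show ?thesis
    by (simp add: Phat_def assoc_legendre_def)
qed auto

text \<open>On this range the sine is nonnegative, so the half-integer power becomes a natural power
  of the sine itself, without an absolute value.\<close>

lemma Phat_cos_of_nat:
  assumes "\<theta> \<in> {0..pi}"
  shows "Phat l (int m) (cos \<theta>) = norm_const l (int m) * sin \<theta> ^ m * poly ((pderiv ^^ m) (legendre l)) (cos \<theta>)"
proof -
  have "sqrt (1 - (cos \<theta>)\<^sup>2) = sin \<theta>"
    using assms by (simp add: sin_squared_eq[symmetric] sin_ge_zero)
  then show ?thesis by (simp add: Phat_of_nat)
qed

text \<open>\<open>dPhat l m (cos \<theta>)\<close> equals the \<open>\<theta>\<close>-derivative of \<open>Phat l m (cos \<theta>)\<close> only on \<open>(0, \<pi>)\<close>,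
  since odd powers of \<open>\<bar>sin \<theta>\<bar>\<close> occur in one of the two. Being continuous everywhere, it can
  replace the derivative under the integral.\<close>

definition dPhat_nonneg :: "nat \<Rightarrow> int \<Rightarrow> real \<Rightarrow> real" where
  "dPhat_nonneg l m x =
     (if m = 0 then - sqrt (real (l * (l + 1))) * Phat l 1 x
      else if m = int l then sqrt (real l / 2) * Phat l (int l - 1) x
      else ctilde1 l m * Phat l (m - 1) x - ctilde2 l m * Phat l (m + 1) x)"

definition dPhat :: "nat \<Rightarrow> int \<Rightarrow> real \<Rightarrow> real" where
  "dPhat l m x = (if m \<ge> 0 then dPhat_nonneg l m x else (-1) ^ nat (- m) * dPhat_nonneg l (- m) x)"

text \<open>The product rule leaves \<open>cos \<theta>\<close> times the derivative of order
  \<open>k\<close>; the differential equation at \<open>x = cos \<theta>\<close> splits this into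
  orders \<open>k - 1\<close> and \<open>k + 1\<close>. The ratios of the normalisations then turn
  into \<open>ctilde1\<close> and \<open>ctilde2\<close>.\<close>

lemma Phat_cos_has_derivative_nonneg:
  assumes "0 \<le> m" "m \<le> int l" "1 \<le> l" and \<theta>: "0 < \<theta>" "\<theta> < pi"
  shows "((\<lambda>\<theta>. Phat l m (cos \<theta>)) has_real_derivative dPhat_nonneg l m (cos \<theta>)) (at \<theta>)"
proof -
  define k where "k = nat m"
  have m: "m = int k" and "k \<le> l" using assms by (auto simp: k_def)
  define q where "q = (\<lambda>j. poly ((pderiv ^^ j) (legendre l)) (cos \<theta>))"
  define K where "K = (\<lambda>j. norm_const l (int j))"
  have P: "Phat l (int j) (cos \<theta>) = K j * sin \<theta> ^ j * q j" for j
    using Phat_cos_of_nat[of \<theta> l j] \<theta> by (simp add: K_def q_def)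
  have "((\<lambda>\<theta>. K k * sin \<theta> ^ k * poly ((pderiv ^^ k) (legendre l)) (cos \<theta>)) has_real_derivative
     K k * (real k * sin \<theta> ^ (k - 1) * cos \<theta> * q k - sin \<theta> ^ (k + 1) * q (k + 1))) (at \<theta>)"
    unfolding q_def
    by (rule derivative_eq_intros DERIV_chain2[OF poly_DERIV] refl)+ (simp add: algebra_simps)
  moreover have "K k * (real k * sin \<theta> ^ (k - 1) * cos \<theta> * q k - sin \<theta> ^ (k + 1) * q (k + 1))
      = dPhat_nonneg l m (cos \<theta>)"
  proof (cases "k = 0")
    case True
    \<comment> \<open>For order 0 only the second term is left, and
      \<open>K 0 = sqrt (l (l + 1)) * K 1\<close>.\<close>
    then show ?thesis
      using P[of 1] norm_const_step[of 0 l] \<open>1 \<le> l\<close>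
      by (simp add: m dPhat_nonneg_def K_def real_sqrt_mult algebra_simps)
  next
    case False
    then obtain j where k: "k = Suc j" by (cases k) auto
    have q: "(real l + real k) * (real l - real k + 1) * q (k - 1)
        = - (sin \<theta>)\<^sup>2 * q (k + 1) + 2 * real k * cos \<theta> * q k"
      using assoc_legendre_ode[of k "cos \<theta>" l] False by (simp add: q_def sin_squared_eq)
    \<comment> \<open>\<open>ctilde1\<close> contributes one square root and the ratio of
      normalisations an equal one, so their product is the radicand.\<close>
    have c1: "ctilde1 l m * K (k - 1) = 1 / 2 * (real l + real k) * (real l - real k + 1) * K k"
    proof -
      define a where "a = (real l + real k) * (real l - real k + 1)"
      have "K (k - 1) = sqrt a * K k"
        using norm_const_step[of j l] \<open>k \<le> l\<close> by (simp add: K_def k a_def algebra_simps)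
      moreover have "ctilde1 l m = 1 / 2 * sqrt a"
        by (simp add: ctilde1_def m a_def)
      ultimately have "ctilde1 l m * K (k - 1) = 1 / 2 * (sqrt a * sqrt a) * K k"
        by (simp only: mult.assoc)
      also have "sqrt a * sqrt a = a"
        using \<open>k \<le> l\<close> by (simp add: a_def)
      finally show ?thesis by (simp only: a_def mult.assoc)
    qed
    \<comment> \<open>The differential equation contributes \<open>+ 1/2\<close> of the term of
      order \<open>k + 1\<close> and the product rule \<open>- 1\<close>; hence \<open>- 1/2\<close>
      in total.\<close>
    have main: "K k * (real k * sin \<theta> ^ (k - 1) * cos \<theta> * q k - sin \<theta> ^ (k + 1) * q (k + 1))
       = ctilde1 l m * (K (k - 1) * sin \<theta> ^ (k - 1) * q (k - 1)) - 1 / 2 * K k * (sin \<theta> ^ (k + 1) * q (k + 1))"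
    proof -
      have "ctilde1 l m * (K (k - 1) * sin \<theta> ^ (k - 1) * q (k - 1))
        = (ctilde1 l m * K (k - 1)) * sin \<theta> ^ (k - 1) * q (k - 1)" by simp
      also have "\<dots> = 1 / 2 * K k * sin \<theta> ^ (k - 1) * ((real l + real k) * (real l - real k + 1) * q (k - 1))"
        unfolding c1 by simp
      finally show ?thesis
        unfolding q by (simp add: k power2_eq_square algebra_simps)
    qed
    show ?thesis
    proof (cases "k = l")
      case True
      \<comment> \<open>At the top order the term of order \<open>l + 1\<close> vanishes by degree,
        and \<open>ctilde1 l l\<close> is \<open>sqrt (l / 2)\<close>.\<close>
      have "ctilde1 l m = sqrt (real l / 2)"
      proof -
        have "of_int ((int l + m) * (int l - m + 1)) = 4 * (real l / 2)"
          using True by (simp add: m)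
        then show ?thesis by (simp only: ctilde1_def real_sqrt_mult real_sqrt_four)
      qed
      moreover have "q (k + 1) = 0"
        using True higher_pderiv_legendre_eq_0[of l "k + 1"] by (simp add: q_def del: funpow.simps)
      moreover have "Phat l (int l - 1) (cos \<theta>) = K (k - 1) * sin \<theta> ^ (k - 1) * q (k - 1)"
        using P[of "k - 1"] True False by (simp add: of_nat_diff)
      ultimately show ?thesis
        unfolding main dPhat_nonneg_def using True False by (simp add: m)
    next
      case neq: False
      \<comment> \<open>The root in \<open>ctilde2\<close> is exactly the ratio of
        \<open>K k\<close> to \<open>K (k + 1)\<close>.\<close>
      have "ctilde2 l m * K (k + 1) = 1 / 2 * K k"
        using norm_const_step[of k l] neq \<open>k \<le> l\<close>
        by (simp add: ctilde2_def m K_def algebra_simps)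
      moreover have "m - 1 = int (k - 1)" "m + 1 = int (k + 1)" using False by (auto simp: m)
      ultimately show ?thesis
        unfolding main dPhat_nonneg_def using neq False
        by (simp only: P m) (simp add: algebra_simps)
    qed
  qed
  ultimately have "((\<lambda>\<theta>. K k * sin \<theta> ^ k * poly ((pderiv ^^ k) (legendre l)) (cos \<theta>))
      has_real_derivative dPhat_nonneg l m (cos \<theta>)) (at \<theta>)" by simp
  \<comment> \<open>The closed form agrees with \<open>Phat l m (cos \<theta>)\<close> on an open
    interval around the point, which suffices for a derivative.\<close>
  then show ?thesis
    by (rule has_field_derivative_transform_within_open[where S = "{0<..<pi}"])
       (use \<theta> in \<open>auto simp: m K_def Phat_cos_of_nat\<close>)
qed

lemma Phat_cos_has_derivative:
  assumes "\<bar>m\<bar> \<le> int l" "1 \<le> l" "0 < \<theta>" "\<theta> < pi"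
  shows "((\<lambda>\<theta>. Phat l m (cos \<theta>)) has_real_derivative dPhat l m (cos \<theta>)) (at \<theta>)"
proof (cases "m \<ge> 0")
  case True
  then show ?thesis
    using Phat_cos_has_derivative_nonneg[of m l \<theta>] assms by (simp add: dPhat_def)
next
  case False
  have "Phat l m = (\<lambda>x. (-1) ^ nat (- m) * Phat l (- m) x)"
    using Phat_uminus[of "- m" l] False assms by (simp add: fun_eq_iff)
  then show ?thesis
    using DERIV_cmult[OF Phat_cos_has_derivative_nonneg[of "- m" l \<theta>], of "(-1) ^ nat (- m)"] False assms
    by (simp add: dPhat_def)
qed

section \<open>Trigonometric expansions\<close>

lemma trig_sum_mult_left:
  "c * trig_sum l m a C S = trig_sum l m a (\<lambda>k. c * C k) (\<lambda>k. c * S k)"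
  by (simp add: trig_sum_def sum_distrib_left distrib_left mult.left_commute)

lemma trig_sum_has_integral:
  assumes "\<And>k. ((\<lambda>x. C x k) has_integral C' k) T" "\<And>k. ((\<lambda>x. S x k) has_integral S' k) T"
  shows "((\<lambda>x. trig_sum l m a (C x) (S x)) has_integral trig_sum l m a C' S') T"
  unfolding trig_sum_def
  by (auto intro!: has_integral_sum has_integral_add has_integral_mult_right assms)

text \<open>Even \<open>m\<close> uses only cosines and odd \<open>m\<close> only sines, so the
  parity in the angle is the parity of \<open>m\<close>.\<close>

lemma trig_sum_uminus_arg:
  "trig_sum l m a (\<lambda>k. cos (- (real k * \<theta>))) (\<lambda>k. sin (- (real k * \<theta>)))
   = (-1) ^ nat \<bar>m\<bar> * trig_sum l m a (\<lambda>k. cos (real k * \<theta>)) (\<lambda>k. sin (real k * \<theta>))"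
  by (simp add: trig_sum_def even_nat_iff sum_negf)

text \<open>The expansion is given on [0, pi]. Every angle differs by a multiple of
  \<open>2 * pi\<close> from \<open>\<theta>'\<close> or \<open>- \<theta>'\<close> with
  \<open>\<theta>'\<close> in that interval. Integer frequencies give periodicity, and reflection
  gives the sign that \<open>Phat_angle\<close> inserts where the sine is negative.\<close>

lemma Phat_angle_eq_trig_sum:
  assumes A: "trig_coeffs A" and lm: "\<bar>m\<bar> \<le> int l"
  shows "Phat_angle l m \<theta> = trig_sum l m (A l m) (\<lambda>k. cos (real k * \<theta>)) (\<lambda>k. sin (real k * \<theta>))"
proof -
  define T where "T = (\<lambda>\<theta>. trig_sum l m (A l m) (\<lambda>k. cos (real k * \<theta>)) (\<lambda>k. sin (real k * \<theta>)))"
  define \<theta>' where "\<theta>' = arccos (cos \<theta>)"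
  have \<theta>': "\<theta>' \<in> {0..pi}" "cos \<theta>' = cos \<theta>"
    by (simp_all add: \<theta>'_def arccos_lbound arccos_ubound cos_arccos)
  have P: "Phat l m (cos \<theta>') = T \<theta>'"
    using A lm \<theta>'(1) by (simp add: trig_coeffs_def T_def)
  have s': "sin \<theta>' \<ge> 0" using \<theta>'(1) by (simp add: sin_ge_zero)
  have per: "cos (real k * (y + 2 * of_int n * pi)) = cos (real k * y)"
    "sin (real k * (y + 2 * of_int n * pi)) = sin (real k * y)" for k y n
  proof -
    have e: "real k * (y + 2 * of_int n * pi) = real k * y + (2 * pi) * of_int (int k * n)"
      by (simp add: algebra_simps)
    show "cos (real k * (y + 2 * of_int n * pi)) = cos (real k * y)"
      "sin (real k * (y + 2 * of_int n * pi)) = sin (real k * y)"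
      unfolding e cos_add sin_add sin_int_2pin cos_int_2pin by simp_all
  qed
  obtain n :: int where "\<theta> = \<theta>' + 2 * of_int n * pi \<or> \<theta> = - \<theta>' + 2 * of_int n * pi"
    using \<theta>'(2) by (metis cos_eq Ints_cases)
  then consider "\<theta> = \<theta>' + 2 * of_int n * pi" | "\<theta> = - \<theta>' + 2 * of_int n * pi" by blast
  then show ?thesis
  proof cases
    case 1
    have "sin \<theta> = sin \<theta>'" using per(2)[of 1 \<theta>' n] 1 by simp
    moreover have "T \<theta> = T \<theta>'" unfolding T_def 1 per ..
    ultimately show ?thesis
      using s' P \<theta>'(2) by (simp add: Phat_angle_def T_def)
  next
    case 2
    have s: "sin \<theta> = - sin \<theta>'" using per(2)[of 1 "- \<theta>'" n] 2 by simp
    have t: "T \<theta> = (-1) ^ nat \<bar>m\<bar> * T \<theta>'"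
      unfolding T_def 2 per using trig_sum_uminus_arg[of l m "A l m" \<theta>'] by simp
    show ?thesis
    proof (cases "sin \<theta> < 0")
      case True
      then show ?thesis using t P \<theta>'(2) by (simp add: Phat_angle_def T_def)
    next
      case False
      \<comment> \<open>A reflected angle with nonnegative sine is a multiple of pi. There all sine
        terms vanish, so for odd \<open>m\<close> the sum is 0 and its sign is irrelevant.\<close>
      then have "sin \<theta>' = 0" using s s' by simp
      then have "\<theta>' = 0 \<or> \<theta>' = pi"
        using \<theta>'(1) sin_gt_zero[of \<theta>'] by force
      then have "sin (real k * \<theta>') = 0" for k by auto
      then have "odd m \<Longrightarrow> T \<theta>' = 0" unfolding T_def trig_sum_def by (simp only: if_False mult_zero_right sum.neutral_const if_cancel)
      then have "T \<theta> = T \<theta>'" using t by (cases "even m") (auto simp: even_nat_iff)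
      then show ?thesis using False P \<theta>'(2) by (simp add: Phat_angle_def T_def)
    qed
  qed
qed

lemma calP_angle_eq_trig_sum:
  assumes "trig_coeffs A" and "\<bar>m\<bar> \<le> int l"
  shows "calP_angle n l m lam \<rho> =
             trig_sum l m (A l m) (\<lambda>k. calC n (real k * lam) (real k * \<rho>))
                                  (\<lambda>k. calS n (real k * lam) (real k * \<rho>))"
proof -
  have "((\<lambda>x. trig_sum l m (A l m)
            (\<lambda>k. poly (legendre n) x * cos (real k * lam * x + real k * \<rho>))
            (\<lambda>k. poly (legendre n) x * sin (real k * lam * x + real k * \<rho>))) has_integral
     trig_sum l m (A l m) (\<lambda>k. calC n (real k * lam) (real k * \<rho>))
                          (\<lambda>k. calS n (real k * lam) (real k * \<rho>))) {-1..1}"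
    unfolding calC_def calS_def
    by (intro trig_sum_has_integral integrable_integral integrable_continuous_real continuous_intros)
  then show ?thesis
    unfolding calP_angle_def Phat_angle_eq_trig_sum[OF assms] trig_sum_mult_left
    by (simp add: integral_unique algebra_simps)
qed

text \<open>The integrands can differ only by the sign that \<open>Phat_angle\<close> inserts where
  the sine is negative. For even \<open>m\<close> this sign is 1, and on [0, pi] the sine is
  nonnegative.\<close>

lemma calP_eq_calP_angle:
  assumes "even m \<or> (\<forall>y\<in>{-1..1}. lam * y + \<rho> \<in> {0..pi})"
  shows "calP n l m lam \<rho> = calP_angle n l m lam \<rho>"
proof -
  have "Phat_angle l m (lam * x + \<rho>) = Phat l m (cos (lam * x + \<rho>))" if "x \<in> {-1..1}" for x
  proof (cases "even m")
    case False
    with assms that have "sin (lam * x + \<rho>) \<ge> 0" by (intro sin_ge_zero) auto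
    then show ?thesis by (simp add: Phat_angle_def)
  qed (simp add: Phat_angle_def even_nat_iff)
  then show ?thesis
    unfolding calP_def calP_angle_def by (intro integral_cong) simp
qed

section \<open>Integrals over the elements\<close>

lemma bdot_frame:
  "bdot (e_r \<theta> \<phi>) (e_r \<theta> \<phi>) = 1" "bdot (e_theta \<theta> \<phi>) (e_theta \<theta> \<phi>) = 1" "bdot (e_phi \<theta> \<phi>) (e_phi \<theta> \<phi>) = 1"
  "bdot (e_r \<theta> \<phi>) (e_theta \<theta> \<phi>) = 0" "bdot (e_r \<theta> \<phi>) (e_phi \<theta> \<phi>) = 0" "bdot (e_theta \<theta> \<phi>) (e_phi \<theta> \<phi>) = 0"
proof -
  define S C s c where sc: "S = complex_of_real (sin \<theta>)" "C = complex_of_real (cos \<theta>)"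
    "s = complex_of_real (sin \<phi>)" "c = complex_of_real (cos \<phi>)"
  have 1: "C\<^sup>2 = 1 - S\<^sup>2" "c\<^sup>2 = 1 - s\<^sup>2"
    unfolding sc of_real_power[symmetric] cos_squared_eq by simp_all
  show "bdot (e_r \<theta> \<phi>) (e_r \<theta> \<phi>) = 1" "bdot (e_theta \<theta> \<phi>) (e_theta \<theta> \<phi>) = 1" "bdot (e_phi \<theta> \<phi>) (e_phi \<theta> \<phi>) = 1"
  "bdot (e_r \<theta> \<phi>) (e_theta \<theta> \<phi>) = 0" "bdot (e_r \<theta> \<phi>) (e_phi \<theta> \<phi>) = 0" "bdot (e_theta \<theta> \<phi>) (e_phi \<theta> \<phi>) = 0"
    using 1 unfolding bdot_def e_r_def e_theta_def e_phi_def sum_3 vector_3 of_real_mult of_real_minus sc[symmetric]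
    by algebra+
qed

lemma bdot_commute: "bdot a b = bdot b a"
  by (simp add: bdot_def mult.commute)

lemma bdot_linear:
  "bdot (a + b) d = bdot a d + bdot b d" "bdot d (a + b) = bdot d a + bdot d b"
  "bdot (k *s a) d = k * bdot a d" "bdot d (k *s a) = k * bdot d a"
  by (simp_all add: bdot_def algebra_simps sum.distrib sum_distrib_left)

lemma vcnj_simps:
  "vcnj (a + b) = vcnj a + vcnj b" "vcnj (k *s a) = cnj k *s vcnj a"
  "vcnj (e_r \<theta> \<phi>) = e_r \<theta> \<phi>" "vcnj (e_theta \<theta> \<phi>) = e_theta \<theta> \<phi>" "vcnj (e_phi \<theta> \<phi>) = e_phi \<theta> \<phi>"
  by (simp_all add: vcnj_def e_r_def e_theta_def e_phi_def vec_eq_iff forall_3 vector_3)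

text \<open>The frame is orthonormal for \<open>bdot\<close> and has real components, so conjugation
  only reaches the coordinates.\<close>

lemma bdot_vcnj_frame:
  "bdot (u *s e_r \<theta> \<phi> + v *s e_theta \<theta> \<phi> + w *s e_phi \<theta> \<phi>)
        (vcnj (a *s e_r \<theta> \<phi> + b *s e_theta \<theta> \<phi> + c *s e_phi \<theta> \<phi>))
   = u * cnj a + v * cnj b + w * cnj c"
  using bdot_frame[of \<theta> \<phi>]
  by (simp add: vcnj_simps bdot_linear bdot_commute[of "e_theta \<theta> \<phi>" "e_r \<theta> \<phi>"]
     bdot_commute[of "e_phi \<theta> \<phi>" "e_r \<theta> \<phi>"] bdot_commute[of "e_phi \<theta> \<phi>" "e_theta \<theta> \<phi>"])

section \<open>Separation of variables and affine substitution\<close>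

lemma product_has_integral_cbox:
  fixes f g :: "real \<Rightarrow> complex"
  assumes f: "continuous_on {a..b} f" and g: "continuous_on {c..d} g"
  shows "((\<lambda>(x, y). f x * g y) has_integral (integral {a..b} f * integral {c..d} g)) (cbox (a, c) (b, d))"
proof -
  have cont: "continuous_on (cbox (a, c) (b, d)) (\<lambda>(x, y). f x * g y)"
    unfolding case_prod_unfold
    by (intro continuous_intros continuous_on_compose2[OF f] continuous_on_compose2[OF g])
       (auto simp: cbox_Pair_eq)
  have "integral (cbox (a, c) (b, d)) (\<lambda>(x, y). f x * g y)
     = integral (cbox a b) (\<lambda>x. integral (cbox c d) (\<lambda>y. f x * g y))"
    using integral_prod_continuous[OF cont] by simp
  also have "\<dots> = integral {a..b} f * integral {c..d} g"
    by simp
  finally show ?thesis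
    using integrable_integral[OF integrable_continuous[OF cont]] by simp
qed

lemma continuous_on_Phat: "continuous_on S (Phat l m)"
proof -
  have "continuous_on S (assoc_legendre_nonneg l k)" for k
    unfolding assoc_legendre_nonneg_def by (intro continuous_intros)
  then show ?thesis
    unfolding Phat_def assoc_legendre_def by (cases "m \<ge> 0") (auto intro!: continuous_intros)
qed

lemma continuous_on_Phat_comp [continuous_intros]:
  "continuous_on S f \<Longrightarrow> continuous_on S (\<lambda>x. Phat l m (f x))"
  using continuous_on_compose2[OF continuous_on_Phat[of UNIV]] by blast

lemma continuous_on_dPhat_comp [continuous_intros]:
  "continuous_on S f \<Longrightarrow> continuous_on S (\<lambda>x. dPhat l m (f x))"
  unfolding dPhat_def dPhat_nonneg_def
  by (cases "m \<ge> 0"; cases "m = 0"; cases "m = int l"; cases "- m = int l")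
     (auto intro!: continuous_intros)

text \<open>The substitution \<open>y = h * x + \<mu>\<close> carries [-1, 1] to the given interval.
  Values in a Banach space let the lemma serve both the real polar and the complex azimuthal
  integrals.\<close>

lemma integral_poly_affine:
  fixes G :: "real \<Rightarrow> 'a::banach"
  assumes G: "continuous_on UNIV G" and less: "th (s - 1) < th s"
    and p: "p = (\<Sum>n = 0..N. smult (v n) (legendre n))"
  defines "h \<equiv> half th s" and "\<mu> \<equiv> mid th s"
  shows "integral {th (s - 1)..th s} (\<lambda>y. poly p ((y - \<mu>) / h) *\<^sub>R G y)
     = h *\<^sub>R (\<Sum>n = 0..N. v n *\<^sub>R integral {-1..1} (\<lambda>x. poly (legendre n) x *\<^sub>R G (h * x + \<mu>)))"
proof -
  have h: "h > 0" "h \<noteq> 0" using less by (auto simp: h_def half_def)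
  have ab: "(th (s - 1) - \<mu>) / h = -1" "(th s - \<mu>) / h = 1"
    using h by (simp_all add: divide_eq_eq) (simp_all add: h_def \<mu>_def half_def mid_def field_simps)
  have cancel: "inverse h * (x * h) = x" for x using h by simp
  define J where "J = (\<Sum>n = 0..N. v n *\<^sub>R integral {-1..1} (\<lambda>x. poly (legendre n) x *\<^sub>R G (h * x + \<mu>)))"
  have "((\<lambda>x. \<Sum>n = 0..N. v n *\<^sub>R (poly (legendre n) x *\<^sub>R G (h * x + \<mu>))) has_integral J) {-1..1}"
    unfolding J_def
    by (intro has_integral_sum has_integral_cmul integrable_integral integrable_continuous_real
          continuous_intros continuous_on_compose2[OF G]) auto
  also have "(\<lambda>x. \<Sum>n = 0..N. v n *\<^sub>R (poly (legendre n) x *\<^sub>R G (h * x + \<mu>)))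
     = (\<lambda>x. poly p x *\<^sub>R G (h * x + \<mu>))"
    by (simp add: p poly_sum scaleR_sum_left fun_eq_iff)
  \<comment> \<open>The integrand is rewritten in \<open>h *\<^sub>R x + \<mu>\<close>, and the
    value is multiplied and divided by the Jacobian, to fit the rule for affine changes of
    variables.\<close>
  finally have "((\<lambda>x. poly p (((h *\<^sub>R x + \<mu>) - \<mu>) / h) *\<^sub>R G (h *\<^sub>R x + \<mu>)) has_integral
      (h *\<^sub>R J) /\<^sub>R h ^ DIM(real)) (cbox ((th (s - 1) - \<mu>) /\<^sub>R h) ((th s - \<mu>) /\<^sub>R h))"
    using h ab by (simp add: divide_inverse mult.commute cancel)
  then have "((\<lambda>y. poly p ((y - \<mu>) / h) *\<^sub>R G y) has_integral (h *\<^sub>R J)) (cbox (th (s - 1)) (th s))"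
    by (subst (asm) has_integral_affinity_iff[OF h(1)])
  then show ?thesis by (simp add: integral_unique J_def)
qed

lemma coef_a_eq_integral:
  assumes "ph (t - 1) < ph t" and p: "p = (\<Sum>n = 0..N. smult (v i n) (legendre n))"
  shows "integral {ph (t - 1)..ph t} (\<lambda>y. of_real (poly p ((y - mid ph t) / half ph t)) * cis (- (of_int m * y)))
     = coef_a N v ph m i t"
proof -
  define h \<mu> where "h = half ph t" and "\<mu> = mid ph t"
  define j where "j = (\<lambda>n. complex_of_real (sph_bessel n (of_int m * h)))"
  have e: "exp (- \<i> * of_int m * of_real \<mu>) = cis (- (of_int m * \<mu>))"
    by (simp add: cis_conv_exp mult_ac)
  \<comment> \<open>The azimuthal factor has negative frequency, so the integral is the conjugate of
    the shifted transform; this turns \<open>i^n\<close> into \<open>i^(-n)\<close>.\<close>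
  have I: "integral {-1..1} (\<lambda>x. of_real (poly (legendre n) x) * cis (- (of_int m * (h * x + \<mu>))))
     = 2 * \<i> powi (- int n) * j n * cis (- (of_int m * \<mu>))" for n
  proof -
    have "(\<lambda>x. of_real (poly (legendre n) x) * cis (- (of_int m * (h * x + \<mu>))))
       = (\<lambda>x. cnj (of_real (poly (legendre n) x) * cis (of_int m * h * x + of_int m * \<mu>)))"
      by (simp add: fun_eq_iff cis_cnj algebra_simps)
    then show ?thesis
      by (simp only: integral_cnj[symmetric] legendre_exp_integral_shift imaginary_unit_powi_uminus)
         (simp add: cis_cnj j_def)
  qed
  have "integral {ph (t - 1)..ph t} (\<lambda>y. of_real (poly p ((y - \<mu>) / h)) * cis (- (of_int m * y)))
     = h *\<^sub>R (\<Sum>n = 0..N. v i n *\<^sub>R (2 * \<i> powi (- int n) * j n * cis (- (of_int m * \<mu>))))"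
    using integral_poly_affine[OF _ assms(1) p, of "\<lambda>y. cis (- (of_int m * y))"]
    by (simp only: I[symmetric] h_def[symmetric] \<mu>_def[symmetric] scaleR_conv_of_real) (simp add: continuous_intros)
  also have "\<dots> = coef_a N v ph m i t"
  proof (cases "m = 0")
    case False
    then show ?thesis
      unfolding coef_a_def h_def[symmetric] \<mu>_def[symmetric] e
      by (simp add: scaleR_conv_of_real sum_distrib_left sum_distrib_right j_def mult_ac)
  next
    case True
    \<comment> \<open>\<open>j_n(0)\<close> vanishes except at \<open>n = 0\<close>, which is why
      order 0 keeps only \<open>v i 0\<close>.\<close>
    have "(\<Sum>n = 0..N. v i n *\<^sub>R (2 * \<i> powi (- int n) * j n)) = (\<Sum>n = 0..N. if n = 0 then 2 * of_real (v i 0) else 0)"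
      by (intro sum.cong) (auto simp: j_def True sph_bessel_0 scaleR_conv_of_real)
    then show ?thesis
      using True by (simp add: coef_a_def scaleR_conv_of_real h_def mult_ac)
  qed
  finally show ?thesis by (simp add: h_def \<mu>_def)
qed

lemma integral_poly_affine_real:
  fixes G :: "real \<Rightarrow> real"
  assumes "continuous_on UNIV G" and "th (s - 1) < th s"
    and "p = (\<Sum>n = 0..N. smult (v j n) (legendre n))"
  shows "integral {th (s - 1)..th s} (\<lambda>y. poly p ((y - mid th s) / half th s) * G y)
     = half th s * (\<Sum>n = 0..N. v j n * integral {-1..1} (\<lambda>x. poly (legendre n) x * G (half th s * x + mid th s)))"
  using integral_poly_affine[OF assms] by simp

text \<open>The elemental map is affine with positive half-widths, hence injective. Membership in
  the rectangle places the preimage inside the reference square, so \<open>inv_into\<close> must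
  return it.\<close>

lemma elem_map_inv_eq:
  assumes "th (s - 1) < th s" "ph (t - 1) < ph t" "(\<theta>, \<phi>) \<in> rect th ph s t"
  shows "elem_map_inv th ph s t (\<theta>, \<phi>) = ((\<theta> - mid th s) / half th s, (\<phi> - mid ph t) / half ph t)"
proof -
  have 1: "half th s > 0" "half ph t > 0" using assms by (auto simp: half_def)
  have "inj (elem_map th ph s t)"
    using 1 by (auto simp: inj_def elem_map_def)
  then have inj: "inj_on (elem_map th ph s t) ({-1..1} \<times> {-1..1})"
    by (rule inj_on_subset) auto
  define y where "y = ((\<theta> - mid th s) / half th s, (\<phi> - mid ph t) / half ph t)"
  have "y \<in> {-1..1} \<times> {-1..1}"
    using 1 assms(3)
    by (auto simp: y_def rect_def divide_le_eq le_divide_eq) (auto simp: half_def mid_def field_simps)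
  moreover have "elem_map th ph s t y = (\<theta>, \<phi>)"
    using 1 by (simp add: y_def elem_map_def)
  ultimately show ?thesis
    unfolding elem_map_inv_def y_def[symmetric] using inv_into_f_f[OF inj] by metis
qed

text \<open>On one element the integrand is a sum of products of a polar and an azimuthal function.
  The weight \<open>G\<close> is left open to cover three cases: \<open>Phat\<close> with and
  without the factor \<open>sin\<close>, and \<open>dPhat\<close> with it.\<close>

lemma element_has_integral:
  fixes G :: "real \<Rightarrow> real"
  assumes coeffs: "lagrange_legendre_coeffs N x v"
    and e: "th (s - 1) < th s" "ph (t - 1) < ph t"
    and u: "\<And>\<theta> \<phi>. (\<theta>, \<phi>) \<in> interior (rect th ph s t) \<Longrightarrow>
        u \<theta> \<phi> = (\<Sum>i = 0..N. \<Sum>j = 0..N. U i j * of_real (psi N x i j (elem_map_inv th ph s t (\<theta>, \<phi>))))"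
    and G: "continuous_on UNIV G"
  shows "((\<lambda>(\<theta>, \<phi>). u \<theta> \<phi> * (of_real (G \<theta>) * cis (- (of_int m * \<phi>)))) has_integral
     (\<Sum>i = 0..N. \<Sum>j = 0..N. U i j * coef_a N v ph m i t *
        of_real (half th s * (\<Sum>n = 0..N. v j n *
           integral {-1..1} (\<lambda>x. poly (legendre n) x * G (half th s * x + mid th s))))))
     (rect th ph s t)"
proof -
  define L where "L = lagrange_basis N x"
  have L: "L i = (\<Sum>n = 0..N. smult (v i n) (legendre n))" if "i \<in> {0..N}" for i
    using coeffs that by (simp add: lagrange_legendre_coeffs_def L_def)
  \<comment> \<open>In \<open>psi\<close> the first index belongs to \<open>\<xi>\<close>, so
    \<open>j\<close> goes with \<open>\<theta>\<close> and \<open>i\<close> with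
    \<open>\<phi>\<close>.\<close>
  define f where "f = (\<lambda>j \<theta>. of_real (poly (L j) ((\<theta> - mid th s) / half th s) * G \<theta>) :: complex)"
  define g where "g = (\<lambda>i \<phi>. of_real (poly (L i) ((\<phi> - mid ph t) / half ph t)) * cis (- (of_int m * \<phi>)))"
  define B where "B = (\<lambda>j. half th s * (\<Sum>n = 0..N. v j n *
           integral {-1..1} (\<lambda>x. poly (legendre n) x * G (half th s * x + mid th s))))"
  have h: "half th s \<noteq> 0" "half ph t \<noteq> 0" using e by (auto simp: half_def)
  have G': "continuous_on S G" for S using G continuous_on_subset by blast
  have rect: "rect th ph s t = cbox (th (s - 1), ph (t - 1)) (th s, ph t)"
    by (simp add: rect_def cbox_Pair_eq)
  have f: "integral {th (s - 1)..th s} (f j) = of_real (B j)" if "j \<in> {0..N}" for j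
  proof -
    have "(\<lambda>y. poly (L j) ((y - mid th s) / half th s) * G y) integrable_on {th (s - 1)..th s}"
      by (intro integrable_continuous_real continuous_intros G') (use h in auto)
    from integral_unique[OF has_integral_of_real[OF integrable_integral[OF this], where 'b = complex]]
    show ?thesis
      using integral_poly_affine_real[where v = v and j = j, OF G e(1) L[OF that]] by (simp add: f_def B_def)
  qed
  have g: "integral {ph (t - 1)..ph t} (g i) = coef_a N v ph m i t" if "i \<in> {0..N}" for i
    using coef_a_eq_integral[where v = v and i = i, OF e(2) L[OF that]] by (simp add: g_def)
  have "((\<lambda>(\<theta>, \<phi>). f j \<theta> * g i \<phi>) has_integral (of_real (B j) * coef_a N v ph m i t)) (rect th ph s t)"
    if "i \<in> {0..N}" "j \<in> {0..N}" for i j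
    unfolding rect f[OF that(2), symmetric] g[OF that(1), symmetric]
    by (rule product_has_integral_cbox) (use h in \<open>auto simp: f_def g_def intro!: continuous_intros G'\<close>)
  then have "((\<lambda>z. \<Sum>i = 0..N. \<Sum>j = 0..N. U i j * (\<lambda>(\<theta>, \<phi>). f j \<theta> * g i \<phi>) z) has_integral
     (\<Sum>i = 0..N. \<Sum>j = 0..N. U i j * (of_real (B j) * coef_a N v ph m i t))) (rect th ph s t)"
    by (intro has_integral_sum has_integral_mult_right) auto
  then have "((\<lambda>(\<theta>, \<phi>). u \<theta> \<phi> * (of_real (G \<theta>) * cis (- (of_int m * \<phi>)))) has_integral
     (\<Sum>i = 0..N. \<Sum>j = 0..N. U i j * (of_real (B j) * coef_a N v ph m i t))) (rect th ph s t)"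
    unfolding rect
  \<comment> \<open>The interpolation formula is available in the interior; the boundary of the
    rectangle is a null set.\<close>
  proof (rule has_integral_spike_interior, clarify)
    fix \<theta> \<phi> assume "(\<theta>, \<phi>) \<in> box (th (s - 1), ph (t - 1)) (th s, ph t)"
    then have 1: "(\<theta>, \<phi>) \<in> interior (rect th ph s t)" by (simp add: rect)
    with interior_subset have 2: "(\<theta>, \<phi>) \<in> rect th ph s t" by blast
    show "u \<theta> \<phi> * (of_real (G \<theta>) * cis (- (of_int m * \<phi>)))
       = (\<Sum>i = 0..N. \<Sum>j = 0..N. U i j * (f j \<theta> * g i \<phi>))"
      unfolding u[OF 1] elem_map_inv_eq[OF e 2] psi_def
      by (simp add: sum_distrib_right sum_distrib_left L_def[symmetric] f_def g_def mult_ac)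
  qed
  also have "(\<Sum>i = 0..N. \<Sum>j = 0..N. U i j * (of_real (B j) * coef_a N v ph m i t))
    = (\<Sum>i = 0..N. \<Sum>j = 0..N. U i j * coef_a N v ph m i t * of_real (B j))"
    by (simp add: mult_ac)
  finally show ?thesis unfolding B_def .
qed

lemma interpolant_has_integral:
  fixes G :: "real \<Rightarrow> real"
  assumes coeffs: "lagrange_legendre_coeffs N x v"
    and part: "element_partition E th ph s t"
    and u: "piecewise_interpolant N x E th ph s t U u"
    and G: "continuous_on UNIV G"
  shows "((\<lambda>(\<theta>, \<phi>). u \<theta> \<phi> * (of_real (G \<theta>) * cis (- (of_int m * \<phi>)))) has_integral
     (\<Sum>e = 1..E. \<Sum>i = 0..N. \<Sum>j = 0..N. U e i j * coef_a N v ph m i (t e) *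
        of_real (half th (s e) * (\<Sum>n = 0..N. v j n *
           integral {-1..1} (\<lambda>x. poly (legendre n) x * G (half th (s e) * x + mid th (s e)))))))
     (cbox (0, 0) (pi, 2 * pi))" (is "(?f has_integral (\<Sum>e = 1..E. ?I e)) _")
proof -
  define R where "R = (\<lambda>e. rect th ph (s e) (t e))"
  have inj: "inj_on R {1..E}" and div: "R ` {1..E} division_of cbox (0, 0) (pi, 2 * pi)"
    using part by (auto simp: element_partition_def R_def)
  have el: "(?f has_integral ?I e) (R e)" if "e \<in> {1..E}" for e
    unfolding R_def using part u that
    by (intro element_has_integral[OF coeffs _ _ _ G])
       (auto simp: element_partition_def piecewise_interpolant_def)
  \<comment> \<open>Additivity over a division sums over the set of rectangles; injectivity of
    \<open>R\<close> turns this back into a sum over element numbers.\<close>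
  have "(?f has_integral (\<Sum>k\<in>R ` {1..E}. ?I (inv_into {1..E} R k))) (cbox (0, 0) (pi, 2 * pi))"
    by (rule has_integral_combine_division[OF div]) (use el inj in \<open>auto simp: inv_into_f_f\<close>)
  then show ?thesis
    using inj by (simp add: sum.reindex inv_into_f_f)
qed

text \<open>\<open>dPhat\<close> combines neighbouring orders of \<open>Phat\<close> with the same
  coefficients with which \<open>coef_d\<close> combines \<open>coef_b\<close>. By linearity
  \<open>coef_d\<close> is therefore the polar integral with weight \<open>dPhat\<close> times
  sine.\<close>

lemma coef_d_eq:
  "coef_d N v th l m j s = half th s * (\<Sum>n = 0..N. v j n *
     integral {-1..1} (\<lambda>x. poly (legendre n) x *
        (dPhat l m (cos (half th s * x + mid th s)) * sin (half th s * x + mid th s))))"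
proof -
  define X where "X = (\<lambda>n k x. poly (legendre n) x * Phat l k (cos (half th s * x + mid th s)) * sin (half th s * x + mid th s))"
  have X: "X n k integrable_on {-1..1}" for n k
    unfolding X_def by (intro integrable_continuous_real continuous_intros)
  have Q: "calQ n l k (half th s) (mid th s) = integral {-1..1} (X n k)" for n k
    by (simp add: calQ_def X_def)
  have "coef_d_nonneg N v th l k j s = half th s * (\<Sum>n = 0..N. v j n *
     integral {-1..1} (\<lambda>x. poly (legendre n) x *
        (dPhat_nonneg l k (cos (half th s * x + mid th s)) * sin (half th s * x + mid th s))))" for k
  proof -
    consider "k = 0" | "k \<noteq> 0" "k = int l" | "k \<noteq> 0" "k \<noteq> int l" by blast
    then show ?thesis
    proof cases
      case 1
      have "(\<lambda>x. poly (legendre n) x *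
        (dPhat_nonneg l k (cos (half th s * x + mid th s)) * sin (half th s * x + mid th s)))
        = (\<lambda>x. - sqrt (real (l * (l + 1))) * X n 1 x)" for n
        using 1 by (simp add: dPhat_nonneg_def X_def fun_eq_iff)
      then show ?thesis
        using 1 by (simp add: coef_d_nonneg_def coef_b_def Q sum_distrib_left sum_negf mult_ac)
    next
      case 2
      then have "(\<lambda>x. poly (legendre n) x *
        (dPhat_nonneg l k (cos (half th s * x + mid th s)) * sin (half th s * x + mid th s)))
        = (\<lambda>x. sqrt (real l / 2) * X n (int l - 1) x)" for n
        by (simp add: dPhat_nonneg_def X_def fun_eq_iff)
      with 2 show ?thesis
        by (simp add: coef_d_nonneg_def coef_b_def Q sum_distrib_left mult_ac)
    next
      case 3
      then have "(\<lambda>x. poly (legendre n) x *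
        (dPhat_nonneg l k (cos (half th s * x + mid th s)) * sin (half th s * x + mid th s)))
        = (\<lambda>x. ctilde1 l k * X n (k - 1) x - ctilde2 l k * X n (k + 1) x)" for n
        by (simp add: dPhat_nonneg_def X_def fun_eq_iff algebra_simps)
      then have "integral {-1..1} (\<lambda>x. poly (legendre n) x *
        (dPhat_nonneg l k (cos (half th s * x + mid th s)) * sin (half th s * x + mid th s)))
        = ctilde1 l k * integral {-1..1} (X n (k - 1)) - ctilde2 l k * integral {-1..1} (X n (k + 1))" for n
        using X by (simp add: integral_diff integrable_on_mult_right)
      with 3 show ?thesis
        by (simp add: coef_d_nonneg_def coef_b_def Q sum_distrib_left right_diff_distrib sum_subtractf mult_ac)
    qed
  qed
  then show ?thesis
    by (simp add: coef_d_def dPhat_def mult.left_commute[of _ "(-1) ^ _"] mult.assoc sum_distrib_left)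
qed

section \<open>Partial derivatives of the spherical harmonics\<close>

lemma Ylm_eq: "Ylm l m \<theta> \<phi> = of_real (Phat l m (cos \<theta>)) * cis (of_int m * \<phi>)"
  by (simp add: Ylm_def cis_conv_exp mult_ac)

lemma dtheta_Ylm_eq:
  assumes "\<bar>m\<bar> \<le> int l" "1 \<le> l" "0 < \<theta>" "\<theta> < pi"
  shows "dtheta_Ylm l m \<theta> \<phi> = of_real (dPhat l m (cos \<theta>)) * cis (of_int m * \<phi>)"
proof -
  have "((\<lambda>t. complex_of_real (Phat l m (cos t))) has_vector_derivative of_real (dPhat l m (cos \<theta>))) (at \<theta>)"
    using Phat_cos_has_derivative[OF assms]
    by (intro has_vector_derivative_of_real) (simp add: has_real_derivative_iff_has_vector_derivative)
  from has_vector_derivative_mult_left[OF this, of "cis (of_int m * \<phi>)"]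
  show ?thesis
    unfolding dtheta_Ylm_def Ylm_eq by (rule vector_derivative_at)
qed

lemma dphi_Ylm_eq: "dphi_Ylm l m \<theta> \<phi> = \<i> * of_int m * Ylm l m \<theta> \<phi>"
proof -
  have "((\<lambda>t. exp (\<i> * of_int m * of_real t)) has_vector_derivative
      (\<i> * of_int m * exp (\<i> * of_int m * of_real \<phi>))) (at \<phi>)"
    by (rule has_vector_derivative_real_field[where f = "\<lambda>z. exp (\<i> * of_int m * z)"])
       (auto intro!: derivative_eq_intros)
  from has_vector_derivative_mult_right[OF this, of "of_real (Phat l m (cos \<theta>))"]
  show ?thesis
    unfolding dphi_Ylm_def Ylm_def by (subst vector_derivative_at) (auto simp: mult_ac)
qed

section \<open>Assembling the three families of coefficients\<close>

theorem proposition3p2: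
  fixes N E :: nat
    and x :: "nat \<Rightarrow> real" and v :: "nat \<Rightarrow> nat \<Rightarrow> real"
    and A :: "nat \<Rightarrow> int \<Rightarrow> nat \<Rightarrow> real"
    and th ph :: "nat \<Rightarrow> real" and s t :: "nat \<Rightarrow> nat"
    and U V W :: "nat \<Rightarrow> nat \<Rightarrow> nat \<Rightarrow> complex"
    and uN vN wN :: "real \<Rightarrow> real \<Rightarrow> complex"
    and F :: "real \<Rightarrow> real \<Rightarrow> complex ^ 3"
    and l :: nat and m :: int
  assumes N: "N \<ge> 1"
    and nodes: "lgl_points N x"
    and coeffs: "lagrange_legendre_coeffs N x v"
    and trig: "trig_coeffs A"
    and partition: "element_partition E th ph s t"
    and uN: "piecewise_interpolant N x E th ph s t U uN"
    and vN: "piecewise_interpolant N x E th ph s t V vN"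
    and wN: "piecewise_interpolant N x E th ph s t W wN"
    and F: "\<And>\<theta> \<phi>. F \<theta> \<phi> = uN \<theta> \<phi> *s e_r \<theta> \<phi> + vN \<theta> \<phi> *s e_theta \<theta> \<phi> + wN \<theta> \<phi> *s e_phi \<theta> \<phi>"
    and lm: "\<bar>m\<bar> \<le> int l"
  shows "(vsh_coeff_r F l m =
           (\<Sum>e = 1..E. \<Sum>i = 0..N. \<Sum>j = 0..N.
              U e i j * coef_a N v ph m i (t e) * of_real (coef_b N v th l m j (s e)))) \<and>
         (l \<ge> 1 \<longrightarrow> vsh_coeff_1 F l m =
           1 / of_nat (l * (l + 1)) * (\<Sum>e = 1..E. \<Sum>i = 0..N. \<Sum>j = 0..N.
              coef_a N v ph m i (t e) *
                (V e i j * of_real (coef_d N v th l m j (s e))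
                 - \<i> * of_int m * W e i j * of_real (coef_c N v th l m j (s e))))) \<and>
         (l \<ge> 1 \<longrightarrow> vsh_coeff_2 F l m =
           - 1 / of_nat (l * (l + 1)) * (\<Sum>e = 1..E. \<Sum>i = 0..N. \<Sum>j = 0..N.
              coef_a N v ph m i (t e) *
                (\<i> * of_int m * V e i j * of_real (coef_c N v th l m j (s e))
                 + W e i j * of_real (coef_d N v th l m j (s e))))) \<and>
         (\<forall>n lam \<rho>. even m \<or> (\<forall>y\<in>{-1..1}. lam * y + \<rho> \<in> {0..pi}) \<longrightarrow>
           calP n l m lam \<rho> =
             trig_sum l m (A l m) (\<lambda>k. calC n (real k * lam) (real k * \<rho>))
                                  (\<lambda>k. calS n (real k * lam) (real k * \<rho>))) \<and>
         (\<forall>n lam \<rho>.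
           calP_angle n l m lam \<rho> =
             trig_sum l m (A l m) (\<lambda>k. calC n (real k * lam) (real k * \<rho>))
                                  (\<lambda>k. calS n (real k * lam) (real k * \<rho>))) \<and>
         (\<forall>n lam \<rho>. calC n lam \<rho> =
           (if lam = 0 then 2 * (if n = 0 then 1 else 0) * cos \<rho>
            else 2 * sph_bessel n lam *
                   (Re (\<i> powi (- int n)) * cos \<rho> + Im (\<i> powi (- int n)) * sin \<rho>))) \<and>
         (\<forall>n lam \<rho>. calS n lam \<rho> =
           (if lam = 0 then 2 * (if n = 0 then 1 else 0) * sin \<rho>
            else 2 * sph_bessel n lam *
                   (Re (\<i> powi (- int n)) * sin \<rho> - Im (\<i> powi (- int n)) * cos \<rho>)))"
proof -
  have c: "continuous_on UNIV (\<lambda>\<theta>. Phat l m (cos \<theta>) * sin \<theta>)" "continuous_on UNIV (\<lambda>\<theta>. Phat l m (cos \<theta>))"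
    "continuous_on UNIV (\<lambda>\<theta>. dPhat l m (cos \<theta>) * sin \<theta>)"
    by (intro continuous_intros)+
  define K where "K = (\<lambda>\<phi>. cis (- (of_int m * \<phi>)))"
  define b c' d where "b = (\<lambda>j e. complex_of_real (coef_b N v th l m j (s e)))"
    and "c' = (\<lambda>j e. complex_of_real (coef_c N v th l m j (s e)))"
    and "d = (\<lambda>j e. complex_of_real (coef_d N v th l m j (s e)))"
  define a where "a = (\<lambda>i e. coef_a N v ph m i (t e))"
  note I = interpolant_has_integral[OF coeffs partition, where m = m]
  \<comment> \<open>The three weights: \<open>Q\<close> carries the sine of the surface measure,
    \<open>P\<close> has lost it against \<open>1 / sin \<theta>\<close>, and \<open>D\<close>
    belongs to the polar derivative.\<close>
  have Q: "((\<lambda>(\<theta>, \<phi>). u \<theta> \<phi> * (of_real (Phat l m (cos \<theta>) * sin \<theta>) * K \<phi>)) has_integral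
       (\<Sum>e = 1..E. \<Sum>i = 0..N. \<Sum>j = 0..N. X e i j * a i e * b j e)) (cbox (0, 0) (pi, 2 * pi))"
    if "piecewise_interpolant N x E th ph s t X u" for X u
    using I[OF that c(1)] unfolding K_def a_def by (simp add: b_def coef_b_def calQ_def mult.assoc)
  have P: "((\<lambda>(\<theta>, \<phi>). u \<theta> \<phi> * (of_real (Phat l m (cos \<theta>)) * K \<phi>)) has_integral
       (\<Sum>e = 1..E. \<Sum>i = 0..N. \<Sum>j = 0..N. X e i j * a i e * c' j e)) (cbox (0, 0) (pi, 2 * pi))"
    if "piecewise_interpolant N x E th ph s t X u" for X u
    using I[OF that c(2)] unfolding K_def a_def by (simp add: c'_def coef_c_def calP_def)
  have D: "((\<lambda>(\<theta>, \<phi>). u \<theta> \<phi> * (of_real (dPhat l m (cos \<theta>) * sin \<theta>) * K \<phi>)) has_integral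
       (\<Sum>e = 1..E. \<Sum>i = 0..N. \<Sum>j = 0..N. X e i j * a i e * d j e)) (cbox (0, 0) (pi, 2 * pi))"
    if "piecewise_interpolant N x E th ph s t X u" for X u
    using I[OF that c(3)] unfolding K_def a_def by (simp add: d_def coef_d_eq)
  have cnj_Y: "cnj (Ylm l m \<theta> \<phi>) = of_real (Phat l m (cos \<theta>)) * K \<phi>" for \<theta> \<phi>
    by (simp add: Ylm_eq K_def cis_cnj)
  have cnj_dY: "cnj (dtheta_Ylm l m \<theta> \<phi>) = of_real (dPhat l m (cos \<theta>)) * K \<phi>"
    if "1 \<le> l" "0 < \<theta>" "\<theta> < pi" for \<theta> \<phi>
    by (simp add: dtheta_Ylm_eq[OF lm that] K_def cis_cnj)
  have r: "vsh_coeff_r F l m = (\<Sum>e = 1..E. \<Sum>i = 0..N. \<Sum>j = 0..N. U e i j * a i e * b j e)"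
  proof -
    have "bdot (F \<theta> \<phi>) (vcnj (Y_vec l m \<theta> \<phi>)) = uN \<theta> \<phi> * cnj (Ylm l m \<theta> \<phi>)" for \<theta> \<phi>
      using bdot_vcnj_frame[where a = "Ylm l m \<theta> \<phi>" and b = 0 and c = 0] by (simp add: F Y_vec_def)
    then have "vsh_coeff_r F l m = integral (cbox (0, 0) (pi, 2 * pi))
        (\<lambda>(\<theta>, \<phi>). uN \<theta> \<phi> * (of_real (Phat l m (cos \<theta>) * sin \<theta>) * K \<phi>))"
      by (simp add: vsh_coeff_r_def sphere_integral_def cnj_Y mult_ac)
    then show ?thesis by (simp only: integral_unique[OF Q[OF uN]])
  qed
  have interior: "0 < \<theta> \<and> \<theta> < pi" if "(\<theta>, \<phi>) \<in> box (0, 0) (pi, 2 * pi)" for \<theta> \<phi> :: real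
    using that by (auto simp: box_def Basis_prod_def)
  have v1: "vsh_coeff_1 F l m = 1 / of_nat (l * (l + 1)) * (\<Sum>e = 1..E. \<Sum>i = 0..N. \<Sum>j = 0..N.
      a i e * (V e i j * d j e - \<i> * of_int m * W e i j * c' j e))" if "l \<ge> 1"
  proof -
    \<comment> \<open>Conjugating the azimuthal derivative yields the factor \<open>- i m\<close>,
      and its \<open>1 / sin \<theta>\<close> cancels the surface factor; so \<open>W\<close> is
      paired with the weight without sine.\<close>
    have "((\<lambda>(\<theta>, \<phi>). of_real (sin \<theta>) * bdot (F \<theta> \<phi>) (vcnj (Psi_vec l m \<theta> \<phi>))) has_integral
        ((\<Sum>e = 1..E. \<Sum>i = 0..N. \<Sum>j = 0..N. V e i j * a i e * d j e)
         + - (\<i> * of_int m) * (\<Sum>e = 1..E. \<Sum>i = 0..N. \<Sum>j = 0..N. W e i j * a i e * c' j e)))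
        (cbox (0, 0) (pi, 2 * pi))"
      using has_integral_add[OF D[OF vN] has_integral_mult_right[OF P[OF wN], of "- (\<i> * of_int m)"]]
    \<comment> \<open>The derivative formula and the cancellation hold for
      \<open>0 < \<theta> < pi\<close>. The open box excludes the poles, and its boundary is
      null.\<close>
    proof (rule has_integral_spike_interior, clarify)
      fix \<theta> \<phi> :: real assume "(\<theta>, \<phi>) \<in> box (0, 0) (pi, 2 * pi)"
      from interior[OF this] have \<theta>: "0 < \<theta>" "\<theta> < pi" "sin \<theta> \<noteq> 0"
        using sin_gt_zero[of \<theta>] by auto
      have "bdot (F \<theta> \<phi>) (vcnj (Psi_vec l m \<theta> \<phi>))
          = vN \<theta> \<phi> * cnj (dtheta_Ylm l m \<theta> \<phi>) + wN \<theta> \<phi> * cnj (of_real (1 / sin \<theta>) * dphi_Ylm l m \<theta> \<phi>)"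
        using bdot_vcnj_frame[where a = 0 and b = "dtheta_Ylm l m \<theta> \<phi>"
            and c = "of_real (1 / sin \<theta>) * dphi_Ylm l m \<theta> \<phi>"] by (simp add: F Psi_vec_def)
      then show "of_real (sin \<theta>) * bdot (F \<theta> \<phi>) (vcnj (Psi_vec l m \<theta> \<phi>))
        = vN \<theta> \<phi> * (of_real (dPhat l m (cos \<theta>) * sin \<theta>) * K \<phi>)
          + - (\<i> * of_int m) * (wN \<theta> \<phi> * (of_real (Phat l m (cos \<theta>)) * K \<phi>))"
        using \<theta> by (simp add: cnj_dY[OF that] dphi_Ylm_eq cnj_Y field_simps)
    qed
    then show ?thesis
      unfolding vsh_coeff_1_def sphere_integral_def
      by (simp add: integral_unique sum_distrib_left sum_subtractf sum_negf algebra_simps)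
  qed
  have v2: "vsh_coeff_2 F l m = - 1 / of_nat (l * (l + 1)) * (\<Sum>e = 1..E. \<Sum>i = 0..N. \<Sum>j = 0..N.
      a i e * (\<i> * of_int m * V e i j * c' j e + W e i j * d j e))" if "l \<ge> 1"
  proof -
    \<comment> \<open>The roles are exchanged: the azimuthal derivative goes with \<open>V\<close>,
      and the polar one with \<open>W\<close> and a minus sign.\<close>
    have "((\<lambda>(\<theta>, \<phi>). of_real (sin \<theta>) * bdot (F \<theta> \<phi>) (vcnj (Phi_vec l m \<theta> \<phi>))) has_integral
        (- (\<Sum>e = 1..E. \<Sum>i = 0..N. \<Sum>j = 0..N. W e i j * a i e * d j e)
         + - (\<i> * of_int m) * (\<Sum>e = 1..E. \<Sum>i = 0..N. \<Sum>j = 0..N. V e i j * a i e * c' j e)))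
        (cbox (0, 0) (pi, 2 * pi))"
      using has_integral_add[OF has_integral_neg[OF D[OF wN]] has_integral_mult_right[OF P[OF vN], of "- (\<i> * of_int m)"]]
    proof (rule has_integral_spike_interior, clarify)
      fix \<theta> \<phi> :: real assume "(\<theta>, \<phi>) \<in> box (0, 0) (pi, 2 * pi)"
      from interior[OF this] have \<theta>: "0 < \<theta>" "\<theta> < pi" "sin \<theta> \<noteq> 0"
        using sin_gt_zero[of \<theta>] by auto
      have Phi: "bdot (F \<theta> \<phi>) (vcnj (Phi_vec l m \<theta> \<phi>))
          = vN \<theta> \<phi> * cnj (of_real (1 / sin \<theta>) * dphi_Ylm l m \<theta> \<phi>) - wN \<theta> \<phi> * cnj (dtheta_Ylm l m \<theta> \<phi>)"
        using bdot_vcnj_frame[where a = 0 and c = "- dtheta_Ylm l m \<theta> \<phi>"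
            and b = "of_real (1 / sin \<theta>) * dphi_Ylm l m \<theta> \<phi>"]
        by (simp add: F Phi_vec_def)
      show "of_real (sin \<theta>) * bdot (F \<theta> \<phi>) (vcnj (Phi_vec l m \<theta> \<phi>))
        = - (wN \<theta> \<phi> * (of_real (dPhat l m (cos \<theta>) * sin \<theta>) * K \<phi>))
          + - (\<i> * of_int m) * (vN \<theta> \<phi> * (of_real (Phat l m (cos \<theta>)) * K \<phi>))"
        unfolding Phi using \<theta> by (simp add: cnj_dY[OF that] dphi_Ylm_eq cnj_Y field_simps)
    qed
    then show ?thesis
      unfolding vsh_coeff_2_def sphere_integral_def
      by (simp add: integral_unique sum_distrib_left sum.distrib sum_negf algebra_simps)
  qed
  show ?thesis
    using r v1 v2 calP_angle_eq_trig_sum[OF trig lm] calP_eq_calP_angle calC_bessel calS_bessel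
    unfolding a_def b_def c'_def d_def by (intro conjI impI allI) simp_all
qed

end
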